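(* For any prime $p$, any $0<\alpha<1$, any $\epsilon>0$, and any integer $m$ satisfying $1\ll_\epsilon m\ll p^{1-\epsilon}$, there exists a subset $Y\subseteq\mathbb{F}_p$ with $|Y|\approx_\alpha m$ and a set $S$ of lines in $\mathbb{F}_p^2$ in general position, each $\alpha$-rich in $Y\times Y$, such that \[ \log|S|\approx_\alpha\sqrt{\frac{\log|Y|}{\log\log|Y|}}. \]
   Context: A line $\ell$ is $\alpha$-rich in $Y\times Y$ if $|\ell\cap(Y\times Y)|\geq\alpha|Y|$. A set of lines is in general position if no two are parallel and no three pass through a common point. $f\ll g$ means $|f|\leq cg$ for a constant $c>0$; a subscript indicates that the constant may depend on that parameter; as a hypothesis, "$1\ll_\epsilon m\ll p^{1-\epsilon}$" means the statement holds for $m$ between suitable constant multiples (depending on $\epsilon$) of $1$ and $p^{1-\epsilon}$. $f\approx_\alpha g$ means $f\ll_\alpha g$ and $g\ll_\alpha f$. *)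

theory Defs
  imports Complex_Main "HOL-Number_Theory.Residues"
begin

text \<open>
  The field with \<open>p\<close> elements is \<open>residue_ring (int p)\<close>, with carrier \<open>{0..p - 1}\<close>. A field given as
  a type (such as the AFP's \<open>mod_ring\<close>) would not allow \<open>p\<close> to be quantified after the implied
  constants, which have to be independent of \<open>p\<close>.
\<close>

abbreviation prime_field :: "nat \<Rightarrow> int ring" where
  "prime_field p \<equiv> residue_ring (int p)"

definition affine_line :: "('a, 'b) ring_scheme \<Rightarrow> 'a \<Rightarrow> 'a \<Rightarrow> 'a \<Rightarrow> ('a \<times> 'a) set" where
  "affine_line F a b c =
     {(x, y) \<in> carrier F \<times> carrier F. a \<otimes>\<^bsub>F\<^esub> x \<oplus>\<^bsub>F\<^esub> b \<otimes>\<^bsub>F\<^esub> y = c}"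

definition nonzero_vectors :: "('a, 'b) ring_scheme \<Rightarrow> ('a \<times> 'a) set" where
  "nonzero_vectors F = carrier F \<times> carrier F - {(\<zero>\<^bsub>F\<^esub>, \<zero>\<^bsub>F\<^esub>)}"

definition lines :: "('a, 'b) ring_scheme \<Rightarrow> ('a \<times> 'a) set set" where
  "lines F = {affine_line F a b c | a b c. (a, b) \<in> nonzero_vectors F \<and> c \<in> carrier F}"

text \<open>Parallel means having a common normal vector \<open>(a, b)\<close>; every line is parallel to itself.\<close>

definition parallel :: "('a, 'b) ring_scheme \<Rightarrow> ('a \<times> 'a) set \<Rightarrow> ('a \<times> 'a) set \<Rightarrow> bool" where
  "parallel F l l' \<longleftrightarrow>
     (\<exists>(a, b) \<in> nonzero_vectors F. \<exists>c \<in> carrier F. \<exists>c' \<in> carrier F.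
        l = affine_line F a b c \<and> l' = affine_line F a b c')"

definition general_position :: "('a, 'b) ring_scheme \<Rightarrow> ('a \<times> 'a) set set \<Rightarrow> bool" where
  "general_position F S \<longleftrightarrow>
     (\<forall>l \<in> S. \<forall>l' \<in> S. l \<noteq> l' \<longrightarrow> \<not> parallel F l l') \<and>
     (\<forall>l \<in> S. \<forall>l' \<in> S. \<forall>l'' \<in> S. l \<noteq> l' \<and> l \<noteq> l'' \<and> l' \<noteq> l'' \<longrightarrow> l \<inter> l' \<inter> l'' = {})"

definition rich :: "real \<Rightarrow> 'a set \<Rightarrow> ('a \<times> 'a) set \<Rightarrow> bool" where
  "rich \<alpha> Y l \<longleftrightarrow> real (card (l \<inter> (Y \<times> Y))) \<ge> \<alpha> * real (card Y)"

text \<open>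
  \<open>f \<lless> g\<close> and \<open>f \<approx> g\<close> with an explicit implied constant \<open>C\<close>. Using one \<open>C\<close> for both directions
  of \<open>\<approx>\<close> is no restriction, since \<open>C\<close> can be increased.
\<close>

definition bounded_by :: "real \<Rightarrow> real \<Rightarrow> real \<Rightarrow> bool" where
  "bounded_by C f g \<longleftrightarrow> \<bar>f\<bar> \<le> C * g"

definition comparable :: "real \<Rightarrow> real \<Rightarrow> real \<Rightarrow> bool" where
  "comparable C f g \<longleftrightarrow> bounded_by C f g \<and> bounded_by C g f"

end

theory Submission
  imports Defs
begin

text \<open>
  Let \<open>P\<close> consist of \<open>r\<close> primes between \<open>2 r\<close> and \<open>r\<^sup>6\<close>, let \<open>Q\<close> be their product, and let
  \<open>k = d r\<close> with \<open>d\<close> depending on \<open>\<alpha>\<close>. The set \<open>Y\<close> consists of the residues of the integers \<open>u i\<close>,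
  where \<open>u\<close> is a monomial in the primes of \<open>P\<close> with exponents below \<open>k\<close>, and \<open>i \<le> M\<close> is divisible
  by no prime of \<open>P\<close>. For a product \<open>a\<close> of distinct primes of \<open>P\<close>, the line \<open>y = a x + Q\<^sup>k a\<^sup>2\<close> maps
  \<open>u i\<close> to \<open>a u (i + w)\<close>, where \<open>w = Q\<^sup>k a / u\<close> is again divisible by all of \<open>P\<close>; so it stays in \<open>Y\<close> unless an
  exponent of \<open>u\<close> is maximal (a proportion at most \<open>r / k = 1 / d\<close>) or \<open>i\<close> is close to \<open>M\<close>.
  The intercept is quadratic in the slope, so the \<open>2\<^sup>r\<close> lines are in general position.
  Few of the integers \<open>u i\<close> collide modulo \<open>p\<close>, because \<open>p\<close> exceeds their number by a large constant factor.
  Finally \<open>r\<close> is taken maximal with \<open>r^(20 d r\<^sup>2) \<le> m\<close>, which makes \<open>r\<close> comparable to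
  \<open>sqrt (log m / log log m)\<close>. That enough primes lie below \<open>r\<^sup>6\<close> follows from Nair's bound
  \<open>2^(n - 1) \<le> lcm(1, \<dots>, n) \<le> n^\<pi>(n)\<close>.
\<close>

section \<open>Nair's lower bound for the least common multiple, and the supply of primes\<close>

text \<open>The recurrence of Leibniz's harmonic triangle with entries 1/(m C(n,m)). It lets
  integrality, after scaling by a common multiple, spread from column 1 to all columns.\<close>

lemma leibniz_triangle_rec:
  assumes "1 \<le> m" "m < n"
  shows "1 / (real (Suc m) * real (n choose Suc m)) =
    1 / (real m * real ((n - 1) choose m)) - 1 / (real m * real (n choose m))"
proof -
  obtain n' where n: "n = Suc n'" using assms by (cases n) auto
  have 1: "Suc m * (n choose Suc m) = (n - m) * (n choose m)"
    using binomial_absorb_comp[of n m] Suc_times_binomial[of m n'] n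
    by (simp add: binomial_absorption)
  have 2: "(n - m) * (n choose m) = n * ((n - 1) choose m)"
    using binomial_absorb_comp[of n m] by simp
  define c where "c = real (n choose m)"
  define b where "b = real ((n - 1) choose m)"
  have c: "c > 0" "b > 0" using assms by (auto simp: c_def b_def)
  have e1: "real (Suc m) * real (n choose Suc m) = (real n - real m) * c"
    using arg_cong[OF 1, of real] assms unfolding c_def of_nat_mult by (simp add: of_nat_diff)
  have e2: "(real n - real m) * c = real n * b"
    using arg_cong[OF 2, of real] assms unfolding b_def c_def of_nat_mult by (simp add: of_nat_diff)
  have "1 / (real m * b) - 1 / (real m * c) = 1 / ((real n - real m) * c)"
    using e2 c assms by (simp add: divide_simps) (simp add: algebra_simps)
  thus ?thesis unfolding e1 c_def b_def by simp
qed

text \<open>Induction on the column of the Leibniz triangle, with the row arbitrary: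
  \<open>D\<close> times an entry of column 1 is \<open>D\<close> divided by the row number, an
  integer by hypothesis, and differences of integers are integers.\<close>

lemma mult_binomial_dvd_common_multiple:
  assumes "1 \<le> m" "m \<le> n" and "\<And>i. i \<in> {1..n} \<Longrightarrow> i dvd D"
  shows "m * (n choose m) dvd D"
proof -
  have "real D / (real m * real (n choose m)) \<in> \<int>"
    using assms
  proof (induction m arbitrary: n rule: dec_induct)
    case base
    hence "n dvd D" "n > 0" by auto
    thus ?case by (auto simp: dvd_def)
  next
    case (step m)
    have "real D / (real m * real (n choose m)) \<in> \<int>"
      using step by auto
    moreover have "real D / (real m * real ((n - 1) choose m)) \<in> \<int>"
      using step by (intro step.IH) auto
    moreover have "real D / (real (Suc m) * real (n choose Suc m)) =
        real D / (real m * real ((n - 1) choose m)) - real D / (real m * real (n choose m))"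
      using arg_cong[OF leibniz_triangle_rec[of m n], of "\<lambda>x. real D * x"] step
      by (simp add: right_diff_distrib)
    ultimately show ?case by (metis Ints_diff)
  qed
  then obtain z :: int where "real D / (real m * real (n choose m)) = of_int z"
    by (auto simp: Ints_def)
  hence "real D = of_int z * (real m * real (n choose m))"
    using assms by (simp add: divide_simps split: if_splits)
  hence "real_of_int (int D) = real_of_int (z * int (m * (n choose m)))" by simp
  hence "int D = z * int (m * (n choose m))" by (simp only: of_int_eq_iff)
  hence "int (m * (n choose m)) dvd int D" by simp
  thus ?thesis by (simp only: int_dvd_int_iff)
qed

text \<open>Each \<open>n * (n' choose j)\<close> equals \<open>Suc j * (n choose Suc j)\<close>, so
  it divides \<open>D\<close>; summing over the \<open>n\<close> values of \<open>j\<close> turns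
  the left side into \<open>n * 2 ^ n'\<close>.\<close>

lemma power2_le_common_multiple:
  assumes "n \<ge> 1" "D > 0" and "\<And>i. i \<in> {1..n} \<Longrightarrow> i dvd D"
  shows "2 ^ (n - 1) \<le> D"
proof -
  obtain n' where n: "n = Suc n'" using assms by (cases n) auto
  have "n * (n' choose j) \<le> D" if "j \<le> n'" for j
  proof -
    have "Suc j * (n choose Suc j) dvd D"
      using assms that n by (intro mult_binomial_dvd_common_multiple) auto
    thus ?thesis using assms(2) Suc_times_binomial[of j n'] n by (auto dest: dvd_imp_le)
  qed
  hence "(\<Sum>j\<le>n'. n * (n' choose j)) \<le> (\<Sum>j\<le>n'. D)" by (intro sum_mono) auto
  hence "n * 2 ^ n' \<le> n * D"
    by (simp only: sum_distrib_left[symmetric] choose_row_sum) (simp add: n)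
  hence "2 ^ n' \<le> D" using nat_mult_le_cancel1[of n "2 ^ n'" D] assms(1) by linarith
  thus ?thesis using n by simp
qed

text \<open>The number \<open>D\<close> below is assembled from the largest power of each prime
  dividing some \<open>i \<le> n\<close>. It is a common multiple of all such \<open>i\<close>, and
  each of its prime powers is at most \<open>n\<close>.\<close>

lemma power2_le_power_card_primes:
  assumes "n \<ge> 1"
  shows "2 ^ (n - 1) \<le> n ^ card {q. prime q \<and> q \<le> n}"
proof -
  define A where "A = {q. prime q \<and> q \<le> n}"
  define e where "e q = Max (multiplicity q ` {1..n})" for q
  have finA: "finite A" unfolding A_def by (rule finite_subset[of _ "{..n}"]) auto
  have le: "q ^ e q \<le> n" for q
  proof -
    have "e q \<in> multiplicity q ` {1..n}" unfolding e_def using assms by (intro Max_in) auto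
    then obtain i where "i \<in> {1..n}" "e q = multiplicity q i" by auto
    thus ?thesis using multiplicity_dvd[of q i] dvd_imp_le[of "q ^ e q" i] by auto
  qed
  define D where "D = (\<Prod>q\<in>A. q ^ e q)"
  have "i dvd D" if i: "i \<in> {1..n}" for i
  proof -
    have "(\<Prod>q\<in>prime_factors i. q ^ multiplicity q i) dvd (\<Prod>q\<in>A. q ^ e q)"
    proof (rule prod_dvd_prod_subset2)
      show "prime_factors i \<subseteq> A"
        using i by (auto simp: A_def prime_factors_dvd dest!: dvd_imp_le)
      show "q ^ multiplicity q i dvd q ^ e q" for q
        unfolding e_def using i by (intro le_imp_power_dvd Max_ge) auto
    qed (use finA in auto)
    thus ?thesis using i by (simp add: D_def prod_prime_factors)
  qed
  moreover have "D > 0" by (auto simp: D_def A_def intro!: prod_pos prime_gt_0_nat)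
  ultimately have "2 ^ (n - 1) \<le> D" using power2_le_common_multiple assms by blast
  also have "D \<le> (\<Prod>q\<in>A. n)" unfolding D_def by (intro prod_mono) (auto simp: le)
  finally show ?thesis by (simp add: A_def)
qed

text \<open>The previous bound at \<open>n = r ^ 6\<close>, with \<open>r \<le> 2 ^ (r - 1)\<close>,
  forces at least \<open>3 * r\<close> primes up to \<open>r ^ 6\<close>; at most
  \<open>2 * r\<close> of them are discarded as too small.\<close>

lemma obtain_primes_of_polynomial_size:
  fixes r :: nat
  assumes "r \<ge> 2"
  obtains P where "finite P" "card P = r" "\<And>q. q \<in> P \<Longrightarrow> prime q \<and> 2 * r < q \<and> q \<le> r ^ 6"
proof -
  define A where "A = {q. prime q \<and> q \<le> r ^ 6}"
  have finA: "finite A" unfolding A_def by (rule finite_subset[of _ "{..r^6}"]) auto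
  have "r \<le> 2 ^ (r - 1)"
    using less_exp[of "r - 1"] assms by linarith
  have "(2::nat) ^ (r ^ 6 - 1) \<le> (r ^ 6) ^ card A"
    unfolding A_def using assms by (intro power2_le_power_card_primes) auto
  also have "\<dots> \<le> ((2 ^ (r - 1)) ^ 6) ^ card A"
    by (intro power_mono \<open>r \<le> 2 ^ (r - 1)\<close>) auto
  also have "\<dots> = 2 ^ ((r - 1) * 6 * card A)" by (simp add: power_mult)
  finally have *: "r ^ 6 - 1 \<le> (r - 1) * 6 * card A" by simp
  have "3 * r \<le> card A"
  proof (rule ccontr)
    assume "\<not> 3 * r \<le> card A"
    hence "(r - 1) * 6 * card A \<le> (r - 1) * 6 * (3 * r)" by (intro mult_mono) auto
    hence "r ^ 6 \<le> 18 * (r * (r - 1)) + 1" using * by (simp add: algebra_simps)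
    \<comment> \<open>The crude bound \<open>2 ^ 4 \<le> r ^ 4\<close> serves to exclude
      \<open>r = 2\<close>; from \<open>r \<ge> 3\<close>, the bound
      \<open>3 ^ 4 \<le> r ^ 4\<close> then gives the contradiction.\<close>
    moreover have "r * r * 2 ^ 4 \<le> r * r * r ^ 4" using assms by (intro mult_mono power_mono) auto
    hence "16 * (r * r) \<le> r ^ 6" by (simp add: eval_nat_numeral)
    moreover have "r * (r - 1) = r * r - r" by (simp add: algebra_simps)
    moreover have "r \<le> r * r" by simp
    ultimately have "r * r * 1 + r * 9 \<le> 0 \<or> 18 * r \<le> 2 * (r * r) + 1" by linarith
    hence "18 * r \<le> 2 * (r * r) + 1" using assms by simp
    hence "r \<ge> 3" using assms by (cases "r = 2") auto
    hence "r * r * 3 ^ 4 \<le> r * r * r ^ 4" by (intro mult_mono power_mono) auto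
    hence "81 * (r * r) \<le> r ^ 6" by (simp add: eval_nat_numeral)
    thus False using \<open>r ^ 6 \<le> 18 * (r * (r - 1)) + 1\<close> \<open>r * (r - 1) = r * r - r\<close> \<open>r \<le> r * r\<close> assms
      by linarith
  qed
  have "card (A - {1..2 * r}) \<ge> r"
    using diff_card_le_card_Diff[of "{1..2*r}" A] \<open>3 * r \<le> card A\<close> by simp
  then obtain P where P: "P \<subseteq> A - {1..2 * r}" "card P = r"
    by (meson obtain_subset_with_card_n)
  show ?thesis
  proof (rule that)
    show "finite P" using P finA finite_subset by (metis finite_Diff)
    show "prime q \<and> 2 * r < q \<and> q \<le> r ^ 6" if "q \<in> P" for q
    proof -
      have "q \<in> A" "q \<notin> {1..2*r}" using that P by auto
      thus ?thesis using prime_ge_1_nat[of q] by (auto simp: A_def)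
    qed
  qed (use P in auto)
qed

section \<open>Lines of given slope and intercept over a prime field\<close>

context residues
begin

text \<open>Coefficients are reduced modulo \<open>m\<close> because \<open>lines\<close> and
  \<open>parallel\<close> admit only elements of the carrier, while slopes and intercepts are
  handled as arbitrary integers.\<close>

definition slope_line :: "int \<Rightarrow> int \<Rightarrow> (int \<times> int) set" where
  "slope_line a b = affine_line R ((- a) mod m) (1 mod m) (b mod m)"

lemma mem_affine_line:
  "(x, y) \<in> affine_line R (a mod m) (b mod m) (c mod m) \<longleftrightarrow>
    x \<in> {0..m - 1} \<and> y \<in> {0..m - 1} \<and> [a * x + b * y = c] (mod m)"
  by (simp add: affine_line_def res_carrier_eq res_mult_eq res_add_eq cong_def mod_simps)

lemma mem_slope_line:
  "(x, y) \<in> slope_line a b \<longleftrightarrow>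
    x \<in> {0..m - 1} \<and> y \<in> {0..m - 1} \<and> [y = a * x + b] (mod m)"
proof -
  have "[(- a) * x + 1 * y = b] (mod m) \<longleftrightarrow> [y = a * x + b] (mod m)"
    by (simp add: cong_iff_dvd_diff algebra_simps)
  thus ?thesis unfolding slope_line_def mem_affine_line by simp
qed

lemma slope_line_in_lines: "slope_line a b \<in> lines R"
proof -
  have "((- a) mod m, 1 mod m) \<in> nonzero_vectors R" "b mod m \<in> carrier R"
    using m_gt_one by (auto simp: nonzero_vectors_def res_carrier_eq res_zero_eq)
  thus ?thesis unfolding lines_def slope_line_def by blast
qed

end

context residues_prime
begin

text \<open>The points with x = 0 and x = 1 force a normal vector \<open>(u, v)\<close> of a line of
  slope \<open>a\<close> to satisfy u + v a = 0 modulo \<open>p\<close>. Subtracting for the two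
  slopes leaves v (a - a') = 0, and v = 0 would make u vanish too.\<close>

lemma parallel_slope_line:
  assumes "parallel R (slope_line a b) (slope_line a' b')"
  shows "[a = a'] (mod int p)"
proof -
  obtain u v c c' where uv: "(u, v) \<in> nonzero_vectors R" "c \<in> carrier R" "c' \<in> carrier R"
    and l: "slope_line a b = affine_line R u v c" "slope_line a' b' = affine_line R u v c'"
    using assms unfolding parallel_def by blast
  have *: "int p dvd u + v * a"
    if "slope_line a b = affine_line R u v c" "c \<in> carrier R" for a b c
  proof -
    have red: "u mod int p = u" "v mod int p = v" "c mod int p = c"
      using uv(1) that(2) by (auto simp: nonzero_vectors_def res_carrier_eq)
    have "(0, b mod int p) \<in> slope_line a b" "(1, (a + b) mod int p) \<in> slope_line a b"
      using m_gt_one by (auto simp: mem_slope_line cong_def)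
    hence "(0, b mod int p) \<in> affine_line R (u mod int p) (v mod int p) (c mod int p)"
      "(1, (a + b) mod int p) \<in> affine_line R (u mod int p) (v mod int p) (c mod int p)"
      unfolding that(1) red .
    hence "[v * (b mod int p) = c] (mod int p)" "[u + v * ((a + b) mod int p) = c] (mod int p)"
      unfolding mem_affine_line by simp_all
    hence "[v * b = c] (mod int p)" "[u + v * (a + b) = c] (mod int p)"
      unfolding cong_def by (metis mod_mult_right_eq, metis mod_mult_right_eq mod_add_right_eq)
    hence "[u + v * (a + b) - v * b = c - c] (mod int p)" by (intro cong_diff) auto
    thus ?thesis by (simp add: cong_iff_dvd_diff algebra_simps)
  qed
  have "int p dvd u + v * a" "int p dvd u + v * a'" using *[OF l(1) uv(2)] *[OF l(2) uv(3)] by auto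
  hence "int p dvd v * (a - a')"
    using dvd_diff[of "int p" "u + v * a" "u + v * a'"] by (simp add: algebra_simps)
  moreover have "\<not> int p dvd v"
  proof
    assume v: "int p dvd v"
    hence "int p dvd u" using \<open>int p dvd u + v * a\<close> by (simp add: dvd_add_left_iff)
    thus False using v uv(1)
      by (auto simp: nonzero_vectors_def res_carrier_eq res_zero_eq dest!: zdvd_imp_le)
  qed
  ultimately show ?thesis
    using p_prime by (auto simp: cong_iff_dvd_diff prime_dvd_mult_iff)
qed

text \<open>Three of the lines \<open>y = a x + c a\<^sup>2\<close> through a point give three roots \<open>a\<close> of a quadratic.\<close>

lemma slope_line_concurrent:
  assumes "\<not> int p dvd c" "z \<in> slope_line a (c * a\<^sup>2)" "z \<in> slope_line b (c * b\<^sup>2)"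
    "z \<in> slope_line e (c * e\<^sup>2)"
  shows "[a = b] (mod int p) \<or> [a = e] (mod int p) \<or> [b = e] (mod int p)"
proof -
  obtain x y where z: "z = (x, y)" by (cases z)
  have *: "int p dvd x + c * (a + b) \<or> [a = b] (mod int p)"
    if "z \<in> slope_line a (c * a\<^sup>2)" "z \<in> slope_line b (c * b\<^sup>2)" for a b
  proof -
    have "[y = a * x + c * a\<^sup>2] (mod int p)" "[y = b * x + c * b\<^sup>2] (mod int p)"
      using that by (auto simp: z mem_slope_line)
    hence "[a * x + c * a\<^sup>2 = b * x + c * b\<^sup>2] (mod int p)"
      using cong_sym cong_trans by blast
    hence "int p dvd (a - b) * (x + c * (a + b))"
      by (simp add: cong_iff_dvd_diff algebra_simps power2_eq_square)
    thus ?thesis using p_prime by (auto simp: cong_iff_dvd_diff prime_dvd_mult_iff)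
  qed
  show ?thesis
  proof (rule ccontr)
    assume neg: "\<not> ?thesis"
    hence "int p dvd x + c * (a + b)" "int p dvd x + c * (a + e)" using * assms by blast+
    hence "int p dvd c * (b - e)"
      using dvd_diff[of "int p" "x + c * (a + b)" "x + c * (a + e)"] by (simp add: algebra_simps)
    hence "[b = e] (mod int p)"
      using p_prime assms(1) by (auto simp: cong_iff_dvd_diff prime_dvd_mult_iff)
    thus False using neg by blast
  qed
qed

text \<open>Congruent slopes below \<open>p\<close> coincide, so the two preceding lemmas exclude
  parallels and triple points. The alternative \<open>card A \<le> 2\<close>, where no triples
  exist, permits \<open>c = 0\<close>, as in the two lines used for small \<open>m\<close>.\<close>

lemma general_position_slope_lines:
  fixes A :: "nat set" and c :: int
  defines "S \<equiv> (\<lambda>a. slope_line (int a) (c * (int a)\<^sup>2)) ` A"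
  assumes A: "A \<subseteq> {..<p}" and c: "card A \<le> 2 \<or> \<not> int p dvd c"
  shows "general_position R S" "card S = card A"
proof -
  have eq: "a = b" if "[int a = int b] (mod int p)" "a \<in> A" "b \<in> A" for a b
    using that A by (auto simp: cong_int_iff intro!: cong_less_modulus_unique_nat)
  have "parallel R (slope_line a b) (slope_line a b)" for a b
  proof -
    have "((- a) mod int p, 1 mod int p) \<in> nonzero_vectors R" "b mod int p \<in> carrier R"
      using m_gt_one by (auto simp: nonzero_vectors_def res_carrier_eq res_zero_eq)
    thus ?thesis unfolding parallel_def slope_line_def by blast
  qed
  hence "inj_on (\<lambda>a. slope_line (int a) (c * (int a)\<^sup>2)) A"
    by (intro inj_onI eq) (metis parallel_slope_line)+
  thus "card S = card A" unfolding S_def by (rule card_image)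
  have "l \<inter> l' \<inter> l'' = {}"
    if "l \<in> S" "l' \<in> S" "l'' \<in> S" "l \<noteq> l'" "l \<noteq> l''" "l' \<noteq> l''" for l l' l''
  proof -
    obtain a b e where abe: "a \<in> A" "b \<in> A" "e \<in> A" "l = slope_line (int a) (c * (int a)\<^sup>2)"
      "l' = slope_line (int b) (c * (int b)\<^sup>2)" "l'' = slope_line (int e) (c * (int e)\<^sup>2)"
      using \<open>l \<in> S\<close> \<open>l' \<in> S\<close> \<open>l'' \<in> S\<close> unfolding S_def by blast
    hence ne: "a \<noteq> b" "a \<noteq> e" "b \<noteq> e" using that(4-6) by auto
    have "card {a, b, e} \<le> card A"
      using abe finite_subset[OF A] by (intro card_mono) auto
    hence "\<not> int p dvd c" using c ne by auto
    show ?thesis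
    proof (rule ccontr)
      assume "l \<inter> l' \<inter> l'' \<noteq> {}"
      then obtain z where "z \<in> l" "z \<in> l'" "z \<in> l''" by blast
      hence "[int a = int b] (mod int p) \<or> [int a = int e] (mod int p) \<or> [int b = int e] (mod int p)"
        using slope_line_concurrent[OF \<open>\<not> int p dvd c\<close>] abe by metis
      thus False using eq abe ne by blast
    qed
  qed
  moreover have "\<not> parallel R l l'" if "l \<in> S" "l' \<in> S" "l \<noteq> l'" for l l'
    using that eq unfolding S_def by (auto dest!: parallel_slope_line)
  ultimately show "general_position R S" unfolding general_position_def by blast
qed

end

section \<open>Counting collisions modulo \<open>p\<close>\<close>

text \<open>Dropping from \<open>Z\<close> every element congruent to a smaller one leaves a set on
  which reduction is injective; the dropped elements are first components of colliding
  pairs.\<close>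

lemma card_mod_image_ge:
  fixes Z :: "nat set"
  assumes "finite Z"
  shows "card Z \<le> card ((\<lambda>z. z mod p) ` Z) +
    card {(x, y) \<in> Z \<times> Z. y < x \<and> x mod p = y mod p}"
proof -
  define C where "C = {(x, y) \<in> Z \<times> Z. y < x \<and> x mod p = y mod p}"
  have finC: "finite C" unfolding C_def by (rule finite_subset[of _ "Z \<times> Z"]) (use assms in auto)
  have "inj_on (\<lambda>z. z mod p) (Z - fst ` C)"
  proof (rule inj_onI)
    fix x y assume xy: "x \<in> Z - fst ` C" "y \<in> Z - fst ` C" "x mod p = y mod p"
    hence "(x, y) \<notin> C" "(y, x) \<notin> C" by force+
    thus "x = y" using xy unfolding C_def by auto
  qed
  hence "card (Z - fst ` C) = card ((\<lambda>z. z mod p) ` (Z - fst ` C))" by (simp add: card_image)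
  also have "\<dots> \<le> card ((\<lambda>z. z mod p) ` Z)" using assms by (intro card_mono) auto
  finally have "card (Z - fst ` C) \<le> card ((\<lambda>z. z mod p) ` Z)" .
  moreover have "card Z \<le> card (Z - fst ` C) + card (fst ` C)"
    using diff_card_le_card_Diff[of "fst ` C" Z] finC by simp
  moreover have "card (fst ` C) \<le> card C" using finC by (rule card_image_le)
  ultimately show ?thesis unfolding C_def by linarith
qed

text \<open>For coprime \<open>u, v\<close>, a solution of \<open>u i - v j = t p\<close> is determined by \<open>t\<close> and
  \<open>j div u\<close>, because \<open>t\<close> fixes \<open>j\<close> modulo \<open>u\<close>.\<close>

lemma card_collisions_coprime:
  fixes u v p M :: nat
  assumes "coprime u v" "0 < u" "u \<le> M" "0 < p"
  shows "p * card {(i, j) \<in> {1..M} \<times> {1..M}. v * j < u * i \<and> p dvd u * i - v * j} \<le> 2 * M\<^sup>2"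
proof -
  define C where "C = {(i, j) \<in> {1..M} \<times> {1..M}. v * j < u * i \<and> p dvd u * i - v * j}"
  define f where "f = (\<lambda>(i, j). ((u * i - v * j) div p, j div u))"
  have "inj_on f C"
  proof (rule inj_onI)
    fix z z' assume z: "z \<in> C" "z' \<in> C" "f z = f z'"
    obtain i j i' j' where ij: "z = (i, j)" "z' = (i', j')" by (cases z, cases z')
    have "p dvd u * i - v * j" "p dvd u * i' - v * j'" "v * j < u * i" "v * j' < u * i'"
      using z ij unfolding C_def by auto
    moreover have "(u * i - v * j) div p = (u * i' - v * j') div p" and div: "j div u = j' div u"
      using z ij by (auto simp: f_def)
    ultimately have "u * i - v * j = u * i' - v * j'" by (metis dvd_mult_div_cancel)
    hence eq: "u * i + v * j' = u * i' + v * j"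
      using \<open>v * j < u * i\<close> \<open>v * j' < u * i'\<close> by linarith
    hence "[v * j' = v * j] (mod u)"
      by (metis cong_def mod_mult_self4)
    hence "[j' = j] (mod u)" using assms(1) using cong_mult_lcancel_nat[of v u j' j] by (simp add: coprime_commute)
    hence "j = j'" using div by (metis cong_def div_mult_mod_eq)
    thus "z = z'" using eq ij assms(2) by simp
  qed
  moreover have "f ` C \<subseteq> {1..u * M div p} \<times> {0..M div u}"
  proof
    fix w assume "w \<in> f ` C"
    then obtain i j where ij: "(i, j) \<in> C" "w = f (i, j)" by auto
    hence h: "i \<le> M" "j \<le> M" "v * j < u * i" "p dvd u * i - v * j" unfolding C_def by auto
    have "u * i - v * j \<le> u * M" using h(1) by (meson diff_le_self le_trans mult_le_mono2)
    hence "(u * i - v * j) div p \<le> u * M div p" by (rule div_le_mono)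
    moreover have "1 \<le> (u * i - v * j) div p"
      using h assms(4) by (auto simp: Suc_le_eq div_greater_zero_iff intro: dvd_imp_le)
    ultimately show "w \<in> {1..u * M div p} \<times> {0..M div u}"
      using ij h(2) by (auto simp: f_def intro: div_le_mono)
  qed
  ultimately have "card C \<le> card ({1..u * M div p} \<times> {0..M div u})"
    by (intro card_inj_on_le[of f]) auto
  also have "\<dots> = (u * M div p) * (M div u + 1)" by simp
  finally have "p * card C \<le> p * ((u * M div p) * (M div u + 1))" by (rule mult_left_mono) simp
  also have "\<dots> = (p * (u * M div p)) * (M div u + 1)" by (rule mult.assoc[symmetric])
  also have "\<dots> \<le> (u * M) * (M div u + 1)" by (intro mult_right_mono) auto
  also have "\<dots> = M * (u * (M div u) + u)" by (simp add: algebra_simps)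
  \<comment> \<open>The last summand \<open>u\<close> stems from the \<open>+ 1\<close> in the
    number of quotients \<open>j div u\<close>; \<open>u \<le> M\<close> keeps it harmless.\<close>
  also have "\<dots> \<le> M * (M + M)" using assms(3) by (intro mult_left_mono add_mono) auto
  also have "\<dots> = 2 * M\<^sup>2" by (simp add: power2_eq_square)
  finally show ?thesis unfolding C_def .
qed

text \<open>Since \<open>p\<close> does not divide \<open>u\<close>, it does not divide the gcd of
  \<open>u\<close> and \<open>v\<close>; cancelling this gcd preserves every collision and leaves
  the coprime case with \<open>u' \<le> u\<close>.\<close>

lemma card_collisions:
  fixes u v p M :: nat
  assumes "prime p" "\<not> p dvd u" "u \<le> M"
  shows "p * card {(i, j) \<in> {1..M} \<times> {1..M}. v * j < u * i \<and> u * i mod p = v * j mod p} \<le> 2 * M\<^sup>2"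
proof -
  define g where "g = gcd u v"
  have u0: "u > 0" using assms(2) by (cases u) auto
  hence g0: "g > 0" by (simp add: g_def)
  obtain u' v' where uv: "u = g * u'" "v = g * v'" "coprime u' v'"
    using gcd_coprime_exists[of u v] u0 unfolding g_def by (metis gcd_eq_0_iff mult.commute not_gr0)
  have "\<not> p dvd g" using assms(2) uv(1) by auto
  have "{(i, j) \<in> {1..M} \<times> {1..M}. v * j < u * i \<and> u * i mod p = v * j mod p} \<subseteq>
    {(i, j) \<in> {1..M} \<times> {1..M}. v' * j < u' * i \<and> p dvd u' * i - v' * j}"
  proof safe
    fix i j assume ij: "v * j < u * i" "u * i mod p = v * j mod p"
    show "v' * j < u' * i" using ij(1) g0 by (simp add: uv)
    have "p dvd u * i - v * j" using ij by (simp add: mod_eq_dvd_iff_nat)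
    also have "u * i - v * j = g * (u' * i - v' * j)" by (simp add: uv diff_mult_distrib2)
    finally show "p dvd u' * i - v' * j" using \<open>\<not> p dvd g\<close> assms(1) by (simp add: prime_dvd_mult_iff)
  qed
  hence "card {(i, j) \<in> {1..M} \<times> {1..M}. v * j < u * i \<and> u * i mod p = v * j mod p} \<le>
    card {(i, j) \<in> {1..M} \<times> {1..M}. v' * j < u' * i \<and> p dvd u' * i - v' * j}"
    by (intro card_mono) (auto intro: finite_subset[of _ "{1..M} \<times> {1..M}"])
  hence "p * card {(i, j) \<in> {1..M} \<times> {1..M}. v * j < u * i \<and> u * i mod p = v * j mod p} \<le>
    p * card {(i, j) \<in> {1..M} \<times> {1..M}. v' * j < u' * i \<and> p dvd u' * i - v' * j}" by simp
  also have "\<dots> \<le> 2 * M\<^sup>2"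
  proof (rule card_collisions_coprime)
    have "u' \<le> u" using uv(1) g0 by simp
    thus "u' \<le> M" using assms(3) by simp
    show "0 < u'" using uv(1) u0 by auto
    show "0 < p" using assms(1) by (rule prime_gt_0_nat)
  qed fact
  finally show ?thesis .
qed

section \<open>Monomials in the chosen primes and sifted integers\<close>

definition prime_monomial :: "nat set \<Rightarrow> (nat \<Rightarrow> nat) \<Rightarrow> nat" where
  "prime_monomial P e = (\<Prod>q\<in>P. q ^ e q)"

definition sifted :: "nat set \<Rightarrow> nat \<Rightarrow> nat set" where
  "sifted P M = {i \<in> {1..M}. \<forall>q\<in>P. \<not> q dvd i}"

text \<open>A prime above \<open>2 * r\<close> divides at most \<open>M / (2 * r)\<close> of the
  integers up to \<open>M\<close>, so \<open>r\<close> of them remove at most half.\<close>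

lemma card_sifted_ge:
  assumes "card P = r" "finite P" "\<And>q. q \<in> P \<Longrightarrow> 2 * r < q"
  shows "M \<le> 2 * card (sifted P M)"
proof -
  define D where "D q = {i \<in> {1..M}. q dvd i}" for q :: nat
  have cardD: "real (card (D q)) \<le> real M / real (2 * r)" if "q \<in> P" for q
  proof -
    have "r > 0" using that assms by (auto simp: card_gt_0_iff)
    have "q * card (D q) \<le> M"
    proof -
      have "D q \<subseteq> (\<lambda>j. q * j) ` {1..M div q}"
      proof
        fix i assume "i \<in> D q"
        then obtain j where "i = q * j" "1 \<le> i" "i \<le> M" by (auto simp: D_def)
        thus "i \<in> (\<lambda>j. q * j) ` {1..M div q}"
          using assms(3)[OF that] by (auto simp: less_eq_div_iff_mult_less_eq mult.commute)
      qed
      hence "card (D q) \<le> M div q"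
        using card_mono[of "(\<lambda>j. q * j) ` {1..M div q}" "D q"] card_image_le[of "{1..M div q}" "\<lambda>j. q * j"] by simp
      hence "q * card (D q) \<le> q * (M div q)" by simp
      also have "\<dots> \<le> M" by simp
      finally show ?thesis .
    qed
    hence "(2 * r) * card (D q) \<le> M" using assms(3)[OF that]
      by (meson le_trans less_imp_le mult_le_mono1)
    hence "real ((2 * r) * card (D q)) \<le> real M" by (simp only: of_nat_le_iff)
    thus ?thesis using \<open>r > 0\<close> by (simp add: field_simps)
  qed
  have "{1..M} \<subseteq> sifted P M \<union> (\<Union>q\<in>P. D q)" by (auto simp: sifted_def D_def)
  hence "M \<le> card (sifted P M \<union> (\<Union>q\<in>P. D q))"
    using card_mono[of "sifted P M \<union> (\<Union>q\<in>P. D q)" "{1..M}"] assms(2)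
    by (auto simp: sifted_def D_def)
  also have "\<dots> \<le> card (sifted P M) + (\<Sum>q\<in>P. card (D q))"
    using card_Un_le[of "sifted P M" "\<Union>q\<in>P. D q"] card_UN_le[OF assms(2), of D] by linarith
  finally have "real M \<le> real (card (sifted P M) + (\<Sum>q\<in>P. card (D q)))"
    by (simp only: of_nat_le_iff)
  also have "\<dots> = real (card (sifted P M)) + (\<Sum>q\<in>P. real (card (D q)))" by simp
  also have "\<dots> \<le> real (card (sifted P M)) + (\<Sum>q\<in>P. real M / real (2 * r))"
    by (intro add_mono sum_mono cardD) auto
  also have "(\<Sum>q\<in>P. real M / real (2 * r)) \<le> real M / 2" using assms(1) by simp
  finally show ?thesis by linarith
qed

lemma prime_monomial_pos:
  assumes "\<And>q. q \<in> P \<Longrightarrow> prime (q :: nat)"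
  shows "0 < prime_monomial P e"
  unfolding prime_monomial_def by (intro prod_pos) (auto dest: assms prime_gt_0_nat)

text \<open>As no prime of \<open>P\<close> divides \<open>i\<close>, the exponent of
  \<open>q\<close> in the product is exactly \<open>e q\<close>. \<open>PiE\<close> fixes the values
  off \<open>P\<close>, so \<open>e\<close> is determined, and cancellation gives
  \<open>i\<close>.\<close>

lemma inj_on_prime_monomial_mult:
  assumes "finite P" "\<And>q. q \<in> P \<Longrightarrow> prime q"
  shows "inj_on (\<lambda>(e, i). prime_monomial P e * i) (PiE P B \<times> sifted P M)"
proof (rule inj_onI, clarify)
  fix e i e' i'
  assume e: "e \<in> PiE P B" "e' \<in> PiE P B" and i: "i \<in> sifted P M" "i' \<in> sifted P M"
    and eq: "prime_monomial P e * i = prime_monomial P e' * i'"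
  have *: "multiplicity q (prime_monomial P e * i) = e q" if "q \<in> P" "i \<in> sifted P M" for q e i
  proof -
    have "multiplicity q (prime_monomial P e) = e q"
      using multiplicity_prod_prime_powers[OF assms(1), of q e] assms(2) that
      by (auto simp: prime_monomial_def)
    moreover have "multiplicity q i = 0"
      using that by (auto simp: sifted_def intro: not_dvd_imp_multiplicity_0)
    moreover have "i \<noteq> 0" using that by (auto simp: sifted_def)
    ultimately show ?thesis
      using assms(2) that prime_monomial_pos[OF assms(2), of P e]
      by (subst prime_elem_multiplicity_mult_distrib) auto
  qed
  have "e q = e' q" if "q \<in> P" for q using * that i eq by metis
  hence "e = e'" using e by (metis PiE_ext)
  thus "e = e' \<and> i = i'" using eq prime_monomial_pos[OF assms(2), of P e] by simp
qed

text \<open>\<open>card_collisions\<close> is summed over the \<open>(k ^ r)\<^sup>2\<close> pairs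
  of exponent vectors; the bound \<open>(\<Prod>P) ^ k \<le> M\<close> keeps each monomial at most
  \<open>M\<close>, as required there.\<close>

lemma card_collisions_monomials:
  assumes "prime p" "finite P" "card P = r" "\<And>q. q \<in> P \<Longrightarrow> prime q \<and> q \<noteq> p"
    and M: "(\<Prod>P) ^ k \<le> M"
    and Z: "Z = (\<lambda>(e, i). prime_monomial P e * i) ` (PiE P (\<lambda>_. {..<k}) \<times> sifted P M)"
  shows "p * card {(x, y) \<in> Z \<times> Z. y < x \<and> x mod p = y mod p} \<le> (k ^ r)\<^sup>2 * (2 * M\<^sup>2)"
proof -
  define E where "E = PiE P (\<lambda>_. {..<k})"
  define C where "C e f = {(i, j) \<in> {1..M} \<times> {1..M}. prime_monomial P f * j < prime_monomial P e * i \<and>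
    prime_monomial P e * i mod p = prime_monomial P f * j mod p}" for e f
  have finE: "finite E" and cardE: "card E = k ^ r"
    using assms(2,3) by (auto simp: E_def card_PiE intro: finite_PiE)
  have finC: "finite (C e f)" for e f
    unfolding C_def by (rule finite_subset[of _ "{1..M} \<times> {1..M}"]) auto
  have C: "p * card (C e f) \<le> 2 * M\<^sup>2" if "e \<in> E" for e f
    unfolding C_def
  proof (rule card_collisions)
    show "\<not> p dvd prime_monomial P e"
    proof
      assume "p dvd prime_monomial P e"
      then obtain q where "q \<in> P" "p dvd q ^ e q"
        using assms(1,2) by (auto simp: prime_monomial_def prime_dvd_prod_iff)
      hence "p = q" using assms(1,4) by (meson prime_dvd_power primes_dvd_imp_eq)
      thus False using assms(4) \<open>q \<in> P\<close> by blast
    qed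
    have "prime_monomial P e \<le> (\<Prod>q\<in>P. q ^ k)"
      unfolding prime_monomial_def
    proof (intro prod_mono conjI)
      fix q assume "q \<in> P"
      hence "1 \<le> q" "e q < k" using that assms(4) prime_ge_1_nat by (auto simp: E_def)
      thus "q ^ e q \<le> q ^ k" by (intro power_increasing) auto
    qed simp
    thus "prime_monomial P e \<le> M" using M by (simp add: prod_power_distrib)
  qed fact
  have "{(x, y) \<in> Z \<times> Z. y < x \<and> x mod p = y mod p} \<subseteq>
    (\<Union>(e, f)\<in>E \<times> E. (\<lambda>(i, j). (prime_monomial P e * i, prime_monomial P f * j)) ` C e f)"
  proof clarify
    fix x y assume xy: "x \<in> Z" "y \<in> Z" "y < x" "x mod p = y mod p"
    obtain e i where ei: "e \<in> E" "i \<in> sifted P M" "x = prime_monomial P e * i"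
      using xy(1) by (auto simp: Z E_def)
    obtain f j where fj: "f \<in> E" "j \<in> sifted P M" "y = prime_monomial P f * j"
      using xy(2) by (auto simp: Z E_def)
    have "(i, j) \<in> C e f" using xy ei fj by (auto simp: C_def sifted_def)
    thus "(x, y) \<in> (\<Union>(e, f)\<in>E \<times> E. (\<lambda>(i, j). (prime_monomial P e * i, prime_monomial P f * j)) ` C e f)"
      using ei fj by force
  qed
  hence "card {(x, y) \<in> Z \<times> Z. y < x \<and> x mod p = y mod p} \<le>
    card (\<Union>(e, f)\<in>E \<times> E. (\<lambda>(i, j). (prime_monomial P e * i, prime_monomial P f * j)) ` C e f)"
    using finE finC by (intro card_mono) auto
  also have "\<dots> \<le> (\<Sum>(e, f)\<in>E \<times> E. card (C e f))"
  proof (rule order_trans[OF card_UN_le])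
    show "(\<Sum>x\<in>E \<times> E. card (case x of (e, f) \<Rightarrow>
        (\<lambda>(i, j). (prime_monomial P e * i, prime_monomial P f * j)) ` C e f)) \<le>
      (\<Sum>(e, f)\<in>E \<times> E. card (C e f))"
      by (intro sum_mono) (auto intro!: card_image_le finC)
  qed (use finE in auto)
  finally have "p * card {(x, y) \<in> Z \<times> Z. y < x \<and> x mod p = y mod p} \<le>
      p * (\<Sum>(e, f)\<in>E \<times> E. card (C e f))" by simp
  also have "\<dots> = (\<Sum>(e, f)\<in>E \<times> E. p * card (C e f))"
    by (simp add: sum_distrib_left case_prod_unfold)
  also have "\<dots> \<le> (\<Sum>(e, f)\<in>E \<times> E. 2 * M\<^sup>2)"
    using C by (intro sum_mono) auto
  also have "\<dots> = (k ^ r)\<^sup>2 * (2 * M\<^sup>2)"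
    by (simp add: card_cartesian_product cardE power2_eq_square)
  finally show ?thesis .
qed

section \<open>Richness of the constructed lines\<close>

text \<open>Each \<open>z\<close> in \<open>Z'\<close> yields the point with coordinates
  \<open>z\<close> and \<open>a * z + b\<close> modulo \<open>p\<close>. The points are counted by
  their first coordinates, and at most \<open>card (Z - Z')\<close> residues are missed.\<close>

lemma (in residues_prime) rich_slope_line:
  fixes Z Z' :: "nat set" and a b :: nat
  assumes Z: "finite Z" "Z' \<subseteq> Z" "\<And>z. z \<in> Z' \<Longrightarrow> a * z + b \<in> Z"
    and card: "\<alpha> * real (card ((\<lambda>z. z mod p) ` Z)) + real (card (Z - Z')) \<le>
      real (card ((\<lambda>z. z mod p) ` Z))"
  shows "rich \<alpha> ((\<lambda>z. int (z mod p)) ` Z) (slope_line (int a) (int b))"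
proof -
  define Y where "Y = (\<lambda>z. int (z mod p)) ` Z"
  define g where "g z = (int (z mod p), int ((a * z + b) mod p))" for z
  have finY: "finite Y" using Z by (simp add: Y_def)
  have "Y = int ` (\<lambda>z. z mod p) ` Z" by (auto simp: Y_def)
  hence cardY: "card Y = card ((\<lambda>z. z mod p) ` Z)" by (simp add: card_image)
  have "g z \<in> slope_line (int a) (int b) \<inter> (Y \<times> Y)" if "z \<in> Z'" for z
  proof -
    have "[int ((a * z + b) mod p) = int a * int (z mod p) + int b] (mod int p)"
      unfolding cong_def of_nat_mod of_nat_add of_nat_mult
      by (metis mod_add_left_eq mod_mod_trivial mod_mult_right_eq)
    moreover have "int (z mod p) \<in> {0..int p - 1}" "int ((a * z + b) mod p) \<in> {0..int p - 1}"
      using m_gt_one by (auto simp: nat_less_as_int[symmetric] of_nat_mod)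
    ultimately show ?thesis
      using that Z unfolding g_def Y_def by (auto simp: mem_slope_line simp del: of_nat_mod)
  qed
  hence "g ` Z' \<subseteq> slope_line (int a) (int b) \<inter> (Y \<times> Y)" by blast
  hence "card (g ` Z') \<le> card (slope_line (int a) (int b) \<inter> (Y \<times> Y))"
    using finY by (intro card_mono) auto
  moreover have "card (fst ` g ` Z') \<le> card (g ` Z')"
    using Z by (intro card_image_le) (auto intro: finite_subset)
  moreover have "card Y \<le> card (fst ` g ` Z') + card (Z - Z')"
  proof -
    have "Y \<subseteq> fst ` g ` Z' \<union> (\<lambda>z. int (z mod p)) ` (Z - Z')"
      unfolding image_image g_def fst_conv Y_def by blast
    hence "card Y \<le> card (fst ` g ` Z' \<union> (\<lambda>z. int (z mod p)) ` (Z - Z'))"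
      using Z by (intro card_mono) (auto intro: finite_subset)
    also have "\<dots> \<le> card (fst ` g ` Z') + card ((\<lambda>z. int (z mod p)) ` (Z - Z'))"
      by (rule card_Un_le)
    also have "card ((\<lambda>z. int (z mod p)) ` (Z - Z')) \<le> card (Z - Z')"
      using Z by (intro card_image_le) auto
    finally show ?thesis by simp
  qed
  ultimately have "card Y \<le> card (slope_line (int a) (int b) \<inter> (Y \<times> Y)) + card (Z - Z')"
    by linarith
  hence "real (card Y) \<le> real (card (slope_line (int a) (int b) \<inter> (Y \<times> Y))) + real (card (Z - Z'))"
    by linarith
  thus ?thesis using card unfolding rich_def Y_def[symmetric] cardY[symmetric] by linarith
qed

text \<open>The shift \<open>Q\<^sup>k a\<^sup>2\<close> is a multiple of every monomial \<open>a u\<close> that occurs, with a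
  quotient divisible by all primes in \<open>P\<close>; this is what keeps the sieved factor sieved.\<close>

lemma slope_line_maps_monomials:
  assumes P: "finite P" "\<And>q. q \<in> P \<Longrightarrow> prime q" and F: "F \<subseteq> P"
    and e: "e \<in> PiE P (\<lambda>_. {..<k - 1})" and i: "i \<in> sifted P M" "i + (\<Prod>P) ^ (k + 1) \<le> M"
    and k: "k \<ge> 1"
  shows "(\<Prod>F) * (prime_monomial P e * i) + (\<Prod>P) ^ k * (\<Prod>F)\<^sup>2 \<in>
    (\<lambda>(e, i). prime_monomial P e * i) ` (PiE P (\<lambda>_. {..<k}) \<times> sifted P M)"
proof -
  define Q where "Q = \<Prod>P"
  define a where "a = \<Prod>F"
  define u where "u = prime_monomial P e"
  \<comment> \<open>Multiplying by \<open>a\<close> raises the exponents of the primes in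
    \<open>F\<close> by one; they stay below \<open>k\<close> since those of \<open>e\<close> are
    below \<open>k - 1\<close>. The value \<open>undefined\<close> off \<open>P\<close> keeps
    \<open>e'\<close> in the \<open>PiE\<close> set.\<close>
  define e' where "e' q = (if q \<in> P then e q + (if q \<in> F then 1 else 0) else undefined)" for q
  have e': "e' \<in> PiE P (\<lambda>_. {..<k})"
    using e by (auto simp: e'_def PiE_iff extensional_def dest!: bspec)
  have "prime_monomial P e' = (\<Prod>q\<in>P. q ^ e q * (if q \<in> F then q else 1))"
    unfolding prime_monomial_def e'_def by (intro prod.cong) auto
  also have "\<dots> = u * a"
    using P(1) F unfolding prod.distrib u_def prime_monomial_def a_def
    by (simp add: prod.inter_restrict[symmetric] Int_absorb1)
  finally have mon: "prime_monomial P e' = u * a" .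
  \<comment> \<open>Since \<open>u\<close> already divides \<open>Q ^ (k - 1)\<close>, one factor
    \<open>Q\<close> of \<open>Q ^ k\<close> is spare; it makes \<open>w\<close> divisible by every
    prime of \<open>P\<close>.\<close>
  have "u dvd (\<Prod>q\<in>P. q ^ (k - 1))"
    unfolding u_def prime_monomial_def using e
    by (intro prod_dvd_prod le_imp_power_dvd) (auto simp: PiE_iff less_imp_le dest!: bspec)
  then obtain t where t: "Q ^ (k - 1) = u * t" unfolding Q_def prod_power_distrib by (auto elim: dvdE)
  define w where "w = Q * t * a"
  have Qk: "Q ^ k = Q * (u * t)" using k t by (cases k) auto
  have Q0: "Q > 0" unfolding Q_def using P prime_gt_0_nat by (auto intro: prod_pos)
  have u0: "u > 0" unfolding u_def using P(2) by (rule prime_monomial_pos)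
  have "a dvd Q" unfolding a_def Q_def using F P(1) by (intro prod_dvd_prod_subset) auto
  hence "a \<le> Q" using Q0 by (rule dvd_imp_le)
  have "w \<le> u * w" using u0 by simp
  also have "u * w = Q ^ k * a" by (simp add: w_def Qk)
  also have "\<dots> \<le> Q ^ k * Q" using \<open>a \<le> Q\<close> by simp
  finally have "w \<le> Q ^ (k + 1)" by (simp add: mult.commute)
  hence "i + w \<le> M" using i(2) unfolding Q_def by linarith
  moreover have "q dvd w" if "q \<in> P" for q
    using that P(1) unfolding w_def Q_def by (intro dvd_mult2) auto
  hence "\<not> q dvd i + w" if "q \<in> P" for q
    using that i(1) by (auto simp: sifted_def dvd_add_left_iff)
  ultimately have "i + w \<in> sifted P M" using i(1) by (auto simp: sifted_def)
  moreover have "a * (u * i) + Q ^ k * a\<^sup>2 = prime_monomial P e' * (i + w)"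
    unfolding mon Qk w_def by (simp add: algebra_simps power2_eq_square)
  ultimately show ?thesis using e' unfolding a_def u_def Q_def by (force simp: image_iff)
qed

text \<open>Here \<open>N\<close> counts exponent vectors, \<open>I\<close> sifted integers and
  \<open>c\<close> collisions, \<open>T\<close> is the margin below \<open>M\<close>, and
  \<open>y\<close> and \<open>w\<close> are the sizes of \<open>Y\<close> and \<open>Z'\<close>.
  Maximal exponents cost at most N I / d, the margin at most N M / (2 d), and collisions let
  \<open>y\<close> replace N I up to N M / 16.\<close>

lemma rich_count_bound:
  fixes d N M I T c y w :: real
  assumes "d \<ge> 4" "N \<ge> 0" "M \<ge> 0" "T \<ge> 0" "M \<le> 2 * I" "2 * d * T \<le> M" "4 * d * c \<le> N * M"
    "N * I \<le> y + c" "(1 - 1 / d) * N * (I - T) \<le> w"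
  shows "N * I - w \<le> 3 / d * y" "N * M \<le> 4 * y"
proof -
  have 1: "N * M \<le> 2 * (N * I)" using mult_left_mono[OF \<open>M \<le> 2 * I\<close> \<open>N \<ge> 0\<close>] by simp
  have 2: "2 * (d * (N * T)) \<le> N * M"
    using mult_left_mono[OF \<open>2 * d * T \<le> M\<close> \<open>N \<ge> 0\<close>] by (simp add: algebra_simps)
  have nt: "N * T \<ge> 0" and "N * M \<ge> 0" using assms by auto
  have c: "16 * c \<le> N * M"
  proof (cases "c \<ge> 0")
    case True
    hence "16 * c \<le> 4 * d * c" using assms(1) by (intro mult_right_mono) auto
    thus ?thesis using assms(7) by linarith
  qed (use \<open>N * M \<ge> 0\<close> in linarith)
  show "N * M \<le> 4 * y" using 1 c assms(8) \<open>N * M \<ge> 0\<close> by linarith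
  have "d * ((1 - 1 / d) * N * (I - T)) \<le> d * w" using assms by (intro mult_left_mono) auto
  also have "d * ((1 - 1 / d) * N * (I - T)) = (d - 1) * (N * I) - d * (N * T) + N * T"
    using assms(1) by (simp add: field_simps)
  finally have "d * (N * I - w) \<le> N * I + d * (N * T) - N * T" by (simp add: algebra_simps)
  also have "\<dots> \<le> 3 * y" using 1 2 c nt assms(8) \<open>N * M \<ge> 0\<close> by linarith
  finally show "N * I - w \<le> 3 / d * y" using assms(1) by (simp add: field_simps)
qed

text \<open>Bernoulli's inequality, applied to the proportion of exponent vectors without a maximal
  entry.\<close>

lemma power_pred_ge:
  fixes d r :: nat
  assumes "d \<ge> 1" "r \<ge> 1"
  shows "(1 - 1 / real d) * real ((d * r) ^ r) \<le> real ((d * r - 1) ^ r)"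
proof -
  have dr: "d * r \<ge> 1" using assms by simp
  have "1 + real r * (- 1 / real (d * r)) \<le> (1 + (- 1 / real (d * r))) ^ r"
    using dr by (intro Bernoulli_inequality) (simp del: of_nat_mult add: divide_simps)
  moreover have "1 + real r * (- 1 / real (d * r)) = 1 - 1 / real d" using assms by (simp add: field_simps)
  ultimately have "(1 - 1 / real d) * real (d * r) ^ r \<le> (1 + (- 1 / real (d * r))) ^ r * real (d * r) ^ r"
    by (intro mult_right_mono) auto
  also have "\<dots> = ((1 + (- 1 / real (d * r))) * real (d * r)) ^ r" by (rule power_mult_distrib[symmetric])
  also have "(1 + (- 1 / real (d * r))) * real (d * r) = real (d * r - 1)"
    using dr by (simp add: field_simps of_nat_diff)
  finally show ?thesis by simp
qed

text \<open>\<open>F\<close> is recovered from its product as the set of primes of \<open>P\<close>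
  dividing it; this yields \<open>2 ^ r\<close> different slopes.\<close>

lemma inj_on_prod_primes:
  assumes "finite P" "\<And>q. q \<in> P \<Longrightarrow> prime (q :: nat)"
  shows "inj_on \<Prod> (Pow P)"
proof (rule inj_onI)
  fix F G assume FG: "F \<in> Pow P" "G \<in> Pow P" "\<Prod>F = \<Prod>G"
  have *: "q \<in> F \<longleftrightarrow> q dvd \<Prod>F" if "q \<in> P" "F \<subseteq> P" for q F
  proof
    assume "q dvd \<Prod>F"
    moreover have "finite F" using that assms(1) finite_subset by blast
    ultimately have "\<exists>s\<in>F. q dvd s"
      using that assms(2) prime_dvd_prod_iff[of F q "\<lambda>x. x"] by auto
    then obtain s where "s \<in> F" "q dvd s" by blast
    thus "q \<in> F" using that assms(2) by (metis primes_dvd_imp_eq subsetD)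
  qed (use that assms(1) finite_subset in \<open>auto intro!: dvd_prodI\<close>)
  show "F = G" using * FG by (metis PowD subsetD subsetI subset_antisym)
qed

text \<open>The first bound in \<open>M\<close> makes the margin at most M / (2 d), the second makes
  the collisions at most \<open>k ^ r\<close> M / (4 d). Then \<open>rich_count_bound\<close> limits
  the loss to a proportion 3 / d of \<open>Y\<close>, which the choice of \<open>d\<close>
  allows.\<close>

lemma exists_rich_lines:
  fixes p r d M k :: nat and P :: "nat set" and \<alpha> :: real
  assumes p: "prime p" and P: "finite P" "card P = r" "\<And>q. q \<in> P \<Longrightarrow> prime q \<and> 2 * r < q"
    and r: "r \<ge> 1" and d: "d \<ge> 4" "3 / real d \<le> 1 - \<alpha>" and k: "k = d * r"
    and M: "2 * d * (\<Prod>P) ^ (k + 1) \<le> M" "8 * d * M * k ^ r \<le> p"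
  obtains Y S where "Y \<subseteq> carrier (prime_field p)" "card Y \<le> k ^ r * M" "k ^ r * M \<le> 4 * card Y"
    "S \<subseteq> lines (prime_field p)" "general_position (prime_field p) S"
    "\<forall>l\<in>S. rich \<alpha> Y l" "card S = 2 ^ r"
proof -
  interpret residues_prime p "prime_field p" by unfold_locales (use p in auto)
  define Q where "Q = \<Prod>P"
  define T where "T = Q ^ (k + 1)"
  define I where "I = sifted P M"
  define N where "N = k ^ r"
  define \<phi> where "\<phi> = (\<lambda>(e, i). prime_monomial P e * i)"
  define Z where "Z = \<phi> ` (PiE P (\<lambda>_. {..<k}) \<times> I)"
  define Z' where "Z' = \<phi> ` (PiE P (\<lambda>_. {..<k - 1}) \<times> {i \<in> I. i + T \<le> M})"
  define C where "C = {(x, y) \<in> Z \<times> Z. y < x \<and> x mod p = y mod p}"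
  define A where "A = \<Prod> ` Pow P"
  define S where "S = (\<lambda>a. slope_line (int a) (int (Q ^ k) * (int a)\<^sup>2)) ` A"
  define Y where "Y = (\<lambda>z. int (z mod p)) ` Z"

  have prP: "\<And>q. q \<in> P \<Longrightarrow> prime q" using P by blast
  have k1: "k \<ge> 1" using k d r by simp
  hence N1: "N \<ge> 1" by (simp add: N_def)
  have Q1: "Q \<ge> 1" unfolding Q_def using prP prime_gt_0_nat by (auto simp: Suc_le_eq intro: prod_pos)
  have "Q ^ k \<le> T" "Q \<le> T" unfolding T_def using Q1 self_le_power[of Q "k + 1"]
    by (auto intro: power_increasing)
  moreover have "T \<le> M" 
  proof -
    have "1 * T \<le> 2 * d * T" using d(1) by (intro mult_right_mono) auto
    thus ?thesis using M(1) unfolding T_def Q_def by linarith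
  qed
  \<comment> \<open>This gives \<open>Q < p\<close>, which separates the slopes modulo
    \<open>p\<close> and keeps \<open>p\<close> out of \<open>P\<close>.\<close>
  moreover have "M < p"
  proof -
    have "M > 0" using \<open>Q \<le> T\<close> \<open>T \<le> M\<close> Q1 by linarith
    moreover have "1 * 1 \<le> d * N" using d(1) N1 by (intro mult_mono) auto
    hence "1 < 8 * (d * N)" by linarith
    ultimately have "1 * M < (8 * (d * N)) * M" by (intro mult_strict_right_mono)
    also have "\<dots> \<le> p" using M(2) by (simp add: N_def algebra_simps)
    finally show ?thesis by simp
  qed
  ultimately have QM: "Q ^ k \<le> M" and Qp: "Q < p" by auto
  have P_ne: "q \<noteq> p" if "q \<in> P" for q
  proof -
    have "q dvd Q" using that P(1) unfolding Q_def by (intro dvd_prodI[of _ _ "\<lambda>x. x", simplified]) auto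
    thus ?thesis using Q1 Qp dvd_imp_le[of q Q] by auto
  qed
  have finI: "finite I" unfolding I_def sifted_def by auto
  have finZ: "finite Z" unfolding Z_def using P(1) finI by (auto intro: finite_PiE)
  have inj: "inj_on \<phi> (PiE P (\<lambda>_. {..<k}) \<times> I)"
    unfolding \<phi>_def I_def using P(1) prP by (rule inj_on_prime_monomial_mult)
  have sub: "PiE P (\<lambda>_. {..<k - 1}) \<times> {i \<in> I. i + T \<le> M} \<subseteq> PiE P (\<lambda>_. {..<k}) \<times> I"
    using PiE_mono[of P "\<lambda>_. {..<k - 1}" "\<lambda>_. {..<k}"] by auto
  have "Z' \<subseteq> Z" unfolding Z_def Z'_def using sub by (rule image_mono)
  have cardZ: "card Z = N * card I"
    unfolding Z_def card_image[OF inj] using P(1,2) by (simp add: card_cartesian_product card_PiE N_def)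
  have cardZ': "card Z' = (k - 1) ^ r * card {i \<in> I. i + T \<le> M}"
    unfolding Z'_def card_image[OF inj_on_subset[OF inj sub]] using P(1,2)
    by (simp add: card_cartesian_product card_PiE)
  \<comment> \<open>A sifted integer is lost only if it is among the last \<open>T\<close> integers
    up to \<open>M\<close>.\<close>
  have cardI': "card I \<le> card {i \<in> I. i + T \<le> M} + T"
  proof -
    have "I \<subseteq> {i \<in> I. i + T \<le> M} \<union> {M - T<..M}" by (auto simp: I_def sifted_def)
    hence "card I \<le> card ({i \<in> I. i + T \<le> M} \<union> {M - T<..M})" using finI by (intro card_mono) auto
    also have "\<dots> \<le> card {i \<in> I. i + T \<le> M} + card {M - T<..M}" by (rule card_Un_le)
    also have "card {M - T<..M} \<le> T" by simp
    finally show ?thesis by simp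
  qed
  have cardY: "card Y = card ((\<lambda>z. z mod p) ` Z)"
  proof -
    have "Y = int ` (\<lambda>z. z mod p) ` Z" by (auto simp: Y_def)
    thus ?thesis by (simp add: card_image)
  qed

  have "p * card C \<le> N\<^sup>2 * (2 * M\<^sup>2)"
    unfolding C_def N_def using p P(1,2) prP P_ne QM
    by (intro card_collisions_monomials) (auto simp: Q_def Z_def \<phi>_def I_def)
  hence "(8 * d * M * N) * card C \<le> N\<^sup>2 * (2 * M\<^sup>2)"
    using M(2) unfolding N_def by (meson le_trans mult_le_mono1)
  hence *: "(2 * N * M) * (4 * d * card C) \<le> (2 * N * M) * (N * M)"
    by (simp add: algebra_simps power2_eq_square)
  hence C: "4 * d * card C \<le> N * M"
  proof -
    have "0 < 2 * N * M" using N1 \<open>T \<le> M\<close> \<open>Q \<le> T\<close> Q1 by simp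
    thus ?thesis using * nat_mult_le_cancel1 by blast
  qed
  have "(1 - 1 / real d) * real N * (real (card I) - real T) \<le> real (card Z')"
  proof -
    have "(1 - 1 / real d) * real N * (real (card I) - real T) \<le>
        (1 - 1 / real d) * real N * real (card {i \<in> I. i + T \<le> M})"
      using cardI' d(1) by (intro mult_left_mono) auto
    also have "\<dots> \<le> real ((k - 1) ^ r) * real (card {i \<in> I. i + T \<le> M})"
      unfolding N_def k using d(1) r by (intro mult_right_mono power_pred_ge) auto
    finally show ?thesis by (simp add: cardZ')
  qed
  note bound = rich_count_bound[of d N M T "card I" "card C" "card Y" "card Z'", OF _ _ _ _ _ _ _ _ this]
  have b: "real N * real (card I) - real (card Z') \<le> 3 / real d * real (card Y)"
    "real N * real M \<le> 4 * real (card Y)"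
  proof -
    have cast: "real a \<le> real b" if "a \<le> b" for a b using that by simp
    have "M \<le> 2 * card I" unfolding I_def using card_sifted_ge[OF P(2,1), of M] P(3) by blast
    from cast[OF this] have 1: "real M \<le> 2 * real (card I)" by simp
    have "2 * d * T \<le> M" using M(1) unfolding T_def Q_def .
    from cast[OF this] have 2: "2 * real d * real T \<le> real M" by simp
    from cast[OF C] have 3: "4 * real d * real (card C) \<le> real N * real M" by simp
    have "card Z \<le> card Y + card C" unfolding cardY C_def using finZ by (rule card_mod_image_ge)
    from cast[OF this] have 4: "real N * real (card I) \<le> real (card Y) + real (card C)"
      by (simp add: cardZ)
    show "real N * real (card I) - real (card Z') \<le> 3 / real d * real (card Y)"
      "real N * real M \<le> 4 * real (card Y)" using bound[OF _ _ _ _ 1 2 3 4] d(1) by auto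
  qed
  have rich_a: "rich \<alpha> Y (slope_line (int a) (int (Q ^ k) * (int a)\<^sup>2))" if "a \<in> A" for a
  proof -
    obtain F where F: "F \<subseteq> P" "a = \<Prod>F" using \<open>a \<in> A\<close> by (auto simp: A_def)
    have "rich \<alpha> Y (slope_line (int a) (int (Q ^ k * a\<^sup>2)))" unfolding Y_def
    proof (rule rich_slope_line)
      show "a * z + Q ^ k * a\<^sup>2 \<in> Z" if z: "z \<in> Z'" for z
      proof -
        obtain e i where "e \<in> PiE P (\<lambda>_. {..<k - 1})" "i \<in> I" "i + T \<le> M" "z = prime_monomial P e * i"
          using z by (auto simp: Z'_def \<phi>_def)
        thus ?thesis unfolding Z_def \<phi>_def F(2) Q_def I_def T_def
          using slope_line_maps_monomials[OF P(1) prP F(1) _ _ _ k1] by blast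
      qed
      have "real (card (Z - Z')) = real N * real (card I) - real (card Z')"
        using \<open>Z' \<subseteq> Z\<close> finZ card_mono[OF finZ \<open>Z' \<subseteq> Z\<close>]
        by (simp add: card_Diff_subset finite_subset of_nat_diff cardZ)
      also have "\<dots> \<le> (1 - \<alpha>) * real (card Y)"
        using b(1) mult_right_mono[OF d(2), of "real (card Y)"] by linarith
      finally show "\<alpha> * real (card ((\<lambda>z. z mod p) ` Z)) + real (card (Z - Z')) \<le>
          real (card ((\<lambda>z. z mod p) ` Z))"
        unfolding cardY by (simp add: algebra_simps)
    qed fact+
    thus ?thesis by simp
  qed
  have "A \<subseteq> {..<p}"
  proof
    fix a assume "a \<in> A"
    then obtain F where "F \<subseteq> P" "a = \<Prod>F" by (auto simp: A_def)
    hence "a dvd Q" using P(1) unfolding Q_def by (auto intro: prod_dvd_prod_subset)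
    thus "a \<in> {..<p}" using Q1 Qp dvd_imp_le[of a Q] by auto
  qed
  \<comment> \<open>Excluding triple points requires that the coefficient \<open>Q ^ k\<close> of
    the quadratic intercept is nonzero modulo \<open>p\<close>.\<close>
  moreover have "\<not> p dvd Q" using Q1 Qp by (auto dest: dvd_imp_le)
  hence "\<not> int p dvd int (Q ^ k)" using p by (auto simp only: int_dvd_int_iff dest: prime_dvd_power)
  ultimately have gp: "general_position (prime_field p) S" "card S = card A"
    unfolding S_def by (intro general_position_slope_lines disjI2; simp)+
  have "card A = 2 ^ r"
    unfolding A_def using inj_on_prod_primes[OF P(1) prP] P(1,2) by (simp add: card_image card_Pow)
  show ?thesis
  proof (rule that)
    show "Y \<subseteq> carrier (prime_field p)"
      using m_gt_one by (auto simp: Y_def res_carrier_eq of_nat_mod)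
    have "card Y \<le> N * card I"
      unfolding cardY cardZ[symmetric] using finZ by (rule card_image_le)
    also have "card I \<le> card {1..M}" unfolding I_def sifted_def by (intro card_mono) auto
    finally show "card Y \<le> k ^ r * M" by (simp add: N_def)
    show "k ^ r * M \<le> 4 * card Y"
    proof -
      have "real (N * M) \<le> real (4 * card Y)" using b(2) by simp
      thus ?thesis unfolding N_def by (simp only: of_nat_le_iff)
    qed
    show "S \<subseteq> lines (prime_field p)" using slope_line_in_lines by (auto simp: S_def)
    show "\<forall>l\<in>S. rich \<alpha> Y l" using rich_a by (auto simp: S_def)
  qed (use gp \<open>card A = 2 ^ r\<close> in auto)
qed

section \<open>Choice of the parameters\<close>

lemma le_power_self_nat:
  fixes d r :: nat
  assumes "r \<ge> 2"
  shows "d \<le> r ^ d"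
  using less_exp[of d] power_mono[of 2 r d] assms by simp

text \<open>The left side is the size of \<open>m\<close> at which \<open>m div (8 * d * N)\<close>,
  with \<open>N = (d * r) ^ r\<close>, reaches \<open>2 * d * Q ^ (d * r + 1)\<close>. By
  \<open>d \<le> r ^ d\<close> everything becomes a power of \<open>r\<close>; the main exponent is
  6 d r^2, and the factor 20 leaves room for the rest.\<close>

lemma parameter_size:
  fixes d r Q :: nat
  assumes d: "d \<ge> 4" and r: "r \<ge> 2" and Q: "Q \<le> r ^ (6 * r)"
  shows "16 * d\<^sup>2 * (d * r) ^ r * Q ^ (d * r + 1) \<le> r ^ (20 * d * r\<^sup>2)"
proof -
  have "16 * d\<^sup>2 \<le> r ^ 4 * (r ^ d)\<^sup>2"
    using power_mono[of 2 r 4] r le_power_self_nat[OF r, of d] by (intro mult_mono power_mono) auto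
  moreover have "(d * r) ^ r \<le> (r ^ d * r) ^ r"
    using le_power_self_nat[OF r, of d] by (intro power_mono mult_right_mono) auto
  moreover have "Q ^ (d * r + 1) \<le> (r ^ (6 * r)) ^ (d * r + 1)" using Q by (intro power_mono) auto
  ultimately have "16 * d\<^sup>2 * (d * r) ^ r * Q ^ (d * r + 1) \<le>
      r ^ 4 * (r ^ d)\<^sup>2 * (r ^ d * r) ^ r * (r ^ (6 * r)) ^ (d * r + 1)"
    by (rule mult_le_mono[OF mult_le_mono])
  also have "\<dots> = r ^ (4 + d * 2 + (d + 1) * r + 6 * r * (d * r + 1))"
    by (simp only: power_add power_mult power_one_right)
  also have "\<dots> \<le> r ^ (20 * d * r\<^sup>2)"
  proof (intro power_increasing)
    have "d * 2 \<le> d * r" "2 * r \<le> d * r" using r d by auto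
    moreover have "d * r * 1 \<le> d * r * r" using r by (intro mult_left_mono) auto
    moreover have "4 + d * 2 + (d + 1) * r + 6 * r * (d * r + 1) = 4 + d * 2 + d * r + 7 * r + 6 * (d * r * r)"
      by (simp add: algebra_simps)
    moreover have "20 * d * r\<^sup>2 = 20 * (d * r * r)" by (simp add: power2_eq_square)
    moreover have "4 \<le> d * 2" using d by simp
    ultimately show "4 + d * 2 + (d + 1) * r + 6 * r * (d * r + 1) \<le> 20 * d * r\<^sup>2" by linarith
  qed (use r in auto)
  finally show ?thesis .
qed

lemma obtain_scale:
  fixes m h :: nat
  assumes "h \<ge> 1" "2 ^ (4 * h) \<le> m"
  obtains r where "r \<ge> 2" "r ^ (h * r\<^sup>2) \<le> m" "m < (r + 1) ^ (h * (r + 1)\<^sup>2)"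
proof -
  define R where "R = {r. r ^ (h * r\<^sup>2) \<le> m}"
  have "R \<subseteq> {..m}"
  proof
    fix r assume "r \<in> R"
    moreover have "r \<le> r ^ (h * r\<^sup>2)" using assms(1) by (cases "r = 0") (auto intro: self_le_power)
    ultimately show "r \<in> {..m}" by (auto simp: R_def)
  qed
  hence fin: "finite R" by (rule finite_subset) simp
  have "2 \<in> R" using assms by (simp add: R_def mult.commute)
  show ?thesis
  proof (rule that[of "Max R"])
    show "Max R \<ge> 2" using fin \<open>2 \<in> R\<close> by (rule Max_ge)
    have "Max R \<in> R" using fin \<open>2 \<in> R\<close> by (intro Max_in) auto
    thus "Max R ^ (h * (Max R)\<^sup>2) \<le> m" by (simp add: R_def)
    have "Max R + 1 \<notin> R"
    proof
      assume "Max R + 1 \<in> R"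
      from Max_ge[OF fin this] show False by simp
    qed
    thus "m < (Max R + 1) ^ (h * (Max R + 1)\<^sup>2)" by (simp add: R_def)
  qed
qed

text \<open>The threshold \<open>2 ^ (80 * d)\<close> is the value of
  \<open>r ^ (20 * d * r\<^sup>2)\<close> at \<open>r = 2\<close>. The bounds on \<open>r\<close>
  are passed on for the comparison of logarithms.\<close>

lemma exists_rich_lines_of_size:
  fixes p d m :: nat and \<alpha> :: real
  assumes p: "prime p" and d: "d \<ge> 4" "3 / real d \<le> 1 - \<alpha>" and m: "2 ^ (80 * d) \<le> m" "m \<le> p"
  obtains Y S r where "Y \<subseteq> carrier (prime_field p)" "card Y \<le> m" "m \<le> 64 * d * card Y"
    "S \<subseteq> lines (prime_field p)" "general_position (prime_field p) S"
    "\<forall>l\<in>S. rich \<alpha> Y l" "card S = 2 ^ r"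
    "r \<ge> 2" "r ^ (20 * d * r\<^sup>2) \<le> m" "m < (r + 1) ^ (20 * d * (r + 1)\<^sup>2)"
proof -
  obtain r where r: "r \<ge> 2" "r ^ (20 * d * r\<^sup>2) \<le> m" "m < (r + 1) ^ (20 * d * (r + 1)\<^sup>2)"
    using obtain_scale[of "20 * d" m] d m by (auto simp: mult.assoc)
  obtain P where P: "finite P" "card P = r" "\<And>q. q \<in> P \<Longrightarrow> prime q \<and> 2 * r < q \<and> q \<le> r ^ 6"
    using obtain_primes_of_polynomial_size[OF r(1)] by metis
  define Q where "Q = \<Prod>P"
  define k where "k = d * r"
  define N where "N = k ^ r"
  \<comment> \<open>The largest \<open>M\<close> with \<open>8 * d * M * N \<le> m\<close>, so that
    the product also stays below \<open>p\<close>.\<close>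
  define M where "M = m div (8 * d * N)"
  have N: "N \<ge> 1" using d r by (simp add: N_def k_def)
  have "Q \<le> (\<Prod>q\<in>P. r ^ 6)" unfolding Q_def using P(3) by (intro prod_mono) auto
  also have "\<dots> = r ^ (6 * r)" using P(2) by (simp add: power_mult)
  finally have Q: "Q \<le> r ^ (6 * r)" .
  have Q1: "Q \<ge> 1" unfolding Q_def using P(3) prime_gt_0_nat by (auto simp: Suc_le_eq intro: prod_pos)
  have "16 * d\<^sup>2 * N * Q ^ (k + 1) \<le> m"
    using parameter_size[OF d(1) r(1) Q] r(2) unfolding N_def k_def by linarith
  hence "(2 * d * Q ^ (k + 1)) * (8 * d * N) \<le> m" by (simp add: algebra_simps power2_eq_square)
  hence M: "2 * d * Q ^ (k + 1) \<le> M"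
    unfolding M_def using d N by (subst less_eq_div_iff_mult_less_eq) auto
  hence "M \<ge> 1" using d Q1 by (metis One_nat_def Suc_leI le_trans mult_pos_pos not_gr0 not_numeral_le_zero zero_less_numeral zero_less_power less_le_trans zero_less_one)
  have M': "8 * d * M * N \<le> m" unfolding M_def by (metis div_times_less_eq_dividend mult.assoc mult.commute)
  have "0 < 8 * d * N" using d N by simp
  from dividend_less_times_div[OF this, of m]
  have "m < 8 * d * N + 8 * d * N * M" unfolding M_def .
  hence "m < (M + 1) * (8 * d * N)" by (simp add: algebra_simps)
  \<comment> \<open>As \<open>M \<ge> 1\<close>, rounding down loses at most a factor 2.\<close>
  also have "\<dots> \<le> (M + M) * (8 * d * N)" using \<open>M \<ge> 1\<close> by (intro mult_right_mono) auto
  finally have m': "m < 16 * d * (N * M)" by (simp add: algebra_simps)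
  obtain Y S where YS: "Y \<subseteq> carrier (prime_field p)" "card Y \<le> k ^ r * M" "k ^ r * M \<le> 4 * card Y"
    "S \<subseteq> lines (prime_field p)" "general_position (prime_field p) S"
    "\<forall>l\<in>S. rich \<alpha> Y l" "card S = 2 ^ r"
  proof (rule exists_rich_lines[OF p P(1,2) _ _ d k_def])
    show "8 * d * M * k ^ r \<le> p" using M' m(2) unfolding N_def by linarith
  qed (use P(3) r M in \<open>auto simp: Q_def\<close>)
  show ?thesis
  proof (rule that[OF YS(1) _ _ YS(4-7) r])
    have "1 * (N * M) \<le> (8 * d) * (N * M)" using d by (intro mult_right_mono) auto
    also have "\<dots> = 8 * d * M * N" by simp
    finally show "card Y \<le> m" using M' YS(2) unfolding N_def by linarith
    have "16 * d * (N * M) \<le> 16 * d * (4 * card Y)" using YS(3) unfolding N_def by (rule mult_left_mono) simp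
    also have "\<dots> = 64 * d * card Y" by simp
    finally show "m \<le> 64 * d * card Y" using m' by linarith
  qed
qed

section \<open>Comparison of logarithms\<close>

lemma comparable_iff:
  assumes "f \<ge> 0" "g \<ge> 0"
  shows "comparable C f g \<longleftrightarrow> f \<le> C * g \<and> g \<le> C * f"
  using assms by (simp add: comparable_def bounded_by_def)

lemma comparable_mono:
  assumes "comparable C f g" "C \<le> C'" "f \<ge> 0" "g \<ge> 0"
  shows "comparable C' f g"
  using assms mult_right_mono[of C C' f] mult_right_mono[of C C' g]
  by (auto simp: comparable_iff)

text \<open>With t = ln r, ln y lies between 4 r^2 t and h r^2 t, and ln ln y between 2 t and 4 h t,
  so their quotient is r^2 up to factors depending on \<open>h\<close>. The factor
  \<open>ln 2\<close> is there because the family has \<open>2 ^ r\<close> lines.\<close>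

lemma comparable_sqrt_ln_ratio:
  fixes r h y :: nat
  assumes r: "r \<ge> 2" and h: "h \<ge> 4" and y: "r ^ (4 * r\<^sup>2) \<le> y" "y \<le> r ^ (h * r\<^sup>2)"
  shows "0 \<le> sqrt (ln (real y) / ln (ln (real y)))"
    and "comparable (2 * real h) (real r * ln 2) (sqrt (ln (real y) / ln (ln (real y))))"
proof -
  define t where "t = ln (real r)"
  have ln2: "1 / 2 \<le> ln (2 :: real)" "ln (2 :: real) \<le> 1"
    using ln_le_minus_one[of "1 / 2 :: real"] ln_le_minus_one[of "2 :: real"] by (auto simp: ln_div)
  have t: "ln 2 \<le> t" using r by (simp add: t_def)
  have "0 < r ^ (4 * r\<^sup>2)" using r by simp
  hence y0: "y > 0" using y by linarith
  have "real (r ^ (4 * r\<^sup>2)) \<le> real y" using y(1) by (simp only: of_nat_le_iff)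
  hence "ln (real (r ^ (4 * r\<^sup>2))) \<le> ln (real y)" using r by (intro ln_mono) auto
  hence lo: "4 * (real r)\<^sup>2 * t \<le> ln (real y)" using r by (simp add: ln_realpow t_def)
  have "real y \<le> real (r ^ (h * r\<^sup>2))" using y(2) by (simp only: of_nat_le_iff)
  hence "ln (real y) \<le> ln (real (r ^ (h * r\<^sup>2)))" using y0 by (intro ln_mono) auto
  hence hi: "ln (real y) \<le> real h * (real r)\<^sup>2 * t" using r by (simp add: ln_realpow t_def)
  have r2: "(real r)\<^sup>2 > 0" using r by simp
  have "(real r)\<^sup>2 * 2 \<le> (real r)\<^sup>2 * (4 * t)" using ln2 t by (intro mult_left_mono) auto
  hence lo': "(real r)\<^sup>2 \<le> ln (real y)" using lo r2 by linarith
  hence "ln ((real r)\<^sup>2) \<le> ln (ln (real y))" using r2 by (intro ln_mono) auto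
  hence lnlo: "2 * t \<le> ln (ln (real y))" using r by (simp add: ln_realpow t_def)
  have "ln (ln (real y)) \<le> ln (real h * (real r)\<^sup>2 * t)"
    using less_le_trans[OF r2 lo'] hi by (intro ln_mono) auto
  also have "\<dots> = ln (real h) + 2 * t + ln t"
    using h r ln2 t by (simp add: ln_mult ln_realpow t_def)
  also have "ln (real h) \<le> real h - 1" using h by (intro ln_le_minus_one) auto
  also have "ln t \<le> t - 1" using ln2 t by (intro ln_le_minus_one) auto
  also have "real h - 1 + 2 * t + (t - 1) \<le> 2 * real h * t + 3 * t"
  proof -
    have "real h * 1 \<le> real h * (2 * t)" using ln2 t by (intro mult_left_mono) auto
    thus ?thesis by linarith
  qed
  also have "\<dots> \<le> 4 * real h * t"
  proof -
    have "3 * t \<le> real h * t" using h ln2 t by (intro mult_right_mono) auto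
    moreover have "0 \<le> real h * t" using ln2 t by simp
    ultimately show ?thesis by linarith
  qed
  finally have lnhi: "ln (ln (real y)) \<le> 4 * real h * t" by simp
  define s where "s = sqrt (ln (real y) / ln (ln (real y)))"
  have pos: "ln (real y) > 0" "ln (ln (real y)) > 0" "t > 0" using lo' r2 lnlo ln2 t by linarith+
  show s0: "0 \<le> sqrt (ln (real y) / ln (ln (real y)))" using pos by simp
  \<comment> \<open>Weakening \<open>h\<close> to its square here and in the upper bound lets the
    root be taken without leaving a root of \<open>h\<close>.\<close>
  have "(real r / real h)\<^sup>2 \<le> ln (real y) / ln (ln (real y))"
  proof -
    have "(real r / real h)\<^sup>2 * ln (ln (real y)) \<le> (real r / real h)\<^sup>2 * (4 * real h * t)"
      using lnhi by (intro mult_left_mono) auto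
    also have "\<dots> = (4 * (real r)\<^sup>2 * t) / real h" using h by (simp add: field_simps power2_eq_square)
    also have "\<dots> \<le> (4 * (real r)\<^sup>2 * t) / 1" using h pos by (intro divide_left_mono) auto
    finally show ?thesis using lo pos by (simp add: le_divide_eq)
  qed
  hence "real r / real h \<le> s" unfolding s_def by (rule real_le_rsqrt)
  hence r_le: "real r \<le> real h * s" using h by (simp add: field_simps)
  have "ln (real y) / ln (ln (real y)) \<le> (real h * real r)\<^sup>2"
  proof -
    have "ln (real y) / ln (ln (real y)) \<le> (real h * (real r)\<^sup>2 * t) / (2 * t)"
      using hi lnlo pos by (intro frac_le) auto
    also have "\<dots> = real h * (real r)\<^sup>2 * (1 / 2)" using pos by simp
    also have "\<dots> \<le> real h * (real r)\<^sup>2 * real h" using h by (intro mult_left_mono) auto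
    also have "\<dots> = (real h * real r)\<^sup>2" by (simp add: power2_eq_square)
    finally show ?thesis .
  qed
  hence s_le: "s \<le> real h * real r" unfolding s_def by (intro real_le_lsqrt) auto
  have "s \<ge> 0" using s0 by (simp add: s_def)
  have "real r * ln 2 \<le> real r" using ln2 by (simp add: mult_left_le)
  moreover have "0 \<le> real h * s" using \<open>s \<ge> 0\<close> by simp
  ultimately have "real r * ln 2 \<le> 2 * real h * s" using r_le by linarith
  moreover have "s \<le> 2 * real h * (real r * ln 2)"
  proof -
    have "real h * real r * (1 / 2) \<le> real h * real r * ln 2" using ln2 by (intro mult_left_mono) auto
    thus ?thesis using s_le by linarith
  qed
  ultimately show "comparable (2 * real h) (real r * ln 2) (sqrt (ln (real y) / ln (ln (real y))))"
    using \<open>s \<ge> 0\<close> ln2 unfolding s_def[symmetric] by (subst comparable_iff) auto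
qed

text \<open>The factor \<open>64 * d\<close> is at most \<open>r ^ (6 + d)\<close>, which the
  exponent absorbs. For the upper bound, \<open>r + 1\<close> is at most \<open>r\<^sup>2\<close> in
  the base and at most \<open>2 * r\<close> in the exponent, turning 20 into 2 * 20 * 4 =
  160.\<close>

lemma scale_bounds:
  fixes r d m y :: nat
  assumes "d \<ge> 4" "r \<ge> 2" "y \<le> m" "m \<le> 64 * d * y"
    "r ^ (20 * d * r\<^sup>2) \<le> m" "m < (r + 1) ^ (20 * d * (r + 1)\<^sup>2)"
  shows "r ^ (4 * r\<^sup>2) \<le> y" "y \<le> r ^ (160 * d * r\<^sup>2)"
proof -
  have r2: "r * 2 \<le> r\<^sup>2" "1 \<le> r\<^sup>2" using assms(2) by (auto simp: power2_eq_square)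
  show "r ^ (4 * r\<^sup>2) \<le> y"
  proof (rule ccontr)
    assume "\<not> r ^ (4 * r\<^sup>2) \<le> y"
    have "64 * d \<le> r ^ 6 * r ^ d"
      using power_mono[of 2 r 6] le_power_self_nat[of r d] assms(2) by (intro mult_mono) auto
    also have "\<dots> = r ^ (6 + d)" by (simp add: power_add)
    finally have "64 * d * y < r ^ (6 + d) * r ^ (4 * r\<^sup>2)"
      using \<open>\<not> r ^ (4 * r\<^sup>2) \<le> y\<close> assms(1,2) by (intro mult_le_less_imp_less) auto
    also have "\<dots> = r ^ (6 + d + 4 * r\<^sup>2)" by (simp add: power_add)
    also have "\<dots> \<le> r ^ (20 * d * r\<^sup>2)"
    proof (intro power_increasing)
      have "d * 1 \<le> d * r\<^sup>2" "4 * r\<^sup>2 \<le> d * r\<^sup>2" using assms(1) r2 by (intro mult_le_mono; simp)+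
      moreover have "20 * d * r\<^sup>2 = 20 * (d * r\<^sup>2)" by simp
      ultimately show "6 + d + 4 * r\<^sup>2 \<le> 20 * d * r\<^sup>2" using assms(1) by linarith
    qed (use assms in auto)
    finally show False using assms by linarith
  qed
  have "y \<le> (r + 1) ^ (20 * d * (r + 1)\<^sup>2)" using assms by linarith
  also have "\<dots> \<le> (r\<^sup>2) ^ (20 * d * (r + 1)\<^sup>2)" using r2 assms(2) by (intro power_mono) linarith+
  also have "\<dots> \<le> (r\<^sup>2) ^ (20 * d * (2 * r)\<^sup>2)"
    using r2 assms(2) by (intro power_increasing mult_left_mono power_mono) auto
  also have "\<dots> = r ^ (2 * (20 * d * (2 * r)\<^sup>2))" by (rule power_mult[symmetric])
  also have "2 * (20 * d * (2 * r)\<^sup>2) = 160 * d * r\<^sup>2" by (simp add: power_mult_distrib)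
  finally show "y \<le> r ^ (160 * d * r\<^sup>2)" .
qed

section \<open>Bounded \<open>m\<close>, and the assembly of the constants\<close>

text \<open>The maps x and -x permute the set {0, 1, -1}, so each of the two lines has three points
  over it. Size 3 is chosen because ln ln 3 is positive.\<close>

lemma exists_two_rich_lines:
  fixes p :: nat and \<alpha> :: real
  assumes p: "prime p" "p \<ge> 5" and \<alpha>: "\<alpha> < 1"
  obtains Y S where "Y \<subseteq> carrier (prime_field p)" "card Y = 3" "S \<subseteq> lines (prime_field p)"
    "general_position (prime_field p) S" "\<forall>l\<in>S. rich \<alpha> Y l" "card S = 2"
proof -
  interpret residues_prime p "prime_field p" by unfold_locales (use p in auto)
  define Y where "Y = {0, 1, int p - 1}"
  define A where "A = {1, p - 1}"
  define S where "S = (\<lambda>a. slope_line (int a) (0 * (int a)\<^sup>2)) ` A"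
  have "card A = 2" "A \<subseteq> {..<p}" using p(2) by (auto simp: A_def)
  hence gp: "general_position (prime_field p) S" "card S = 2"
    using general_position_slope_lines[of A 0] unfolding S_def by auto
  have cardY: "card Y = 3" using p(2) by (auto simp: Y_def card_insert_if)
  have "rich \<alpha> Y (slope_line (int a) 0)" if "a \<in> A" for a
  proof -
    define b where "b = (if a = 1 then 1 else int p - 1)"
    define c where "c = (if a = 1 then int p - 1 else 1)"
    have "int a = b" using that p(2) by (auto simp: A_def b_def of_nat_diff)
    hence "{(0, 0), (1, b), (int p - 1, c)} \<subseteq> slope_line (int a) 0 \<inter> (Y \<times> Y)"
      using p(2) unfolding b_def c_def
      by (auto simp: mem_slope_line Y_def cong_iff_dvd_diff algebra_simps)
    moreover have "finite (slope_line (int a) 0 \<inter> (Y \<times> Y))" by (auto simp: Y_def)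
    ultimately have "card {(0, 0), (1, b), (int p - 1, c)} \<le> card (slope_line (int a) 0 \<inter> (Y \<times> Y))"
      by (intro card_mono)
    moreover have "card {(0, 0), (1, b), (int p - 1, c)} = 3" using p(2) by (simp add: card_insert_if)
    ultimately show ?thesis unfolding rich_def cardY using \<alpha> by simp
  qed
  hence "\<forall>l\<in>S. rich \<alpha> Y l" by (auto simp: S_def)
  moreover have "Y \<subseteq> carrier (prime_field p)" using p(2) by (auto simp: Y_def res_carrier_eq)
  moreover have "S \<subseteq> lines (prime_field p)" using slope_line_in_lines by (auto simp: S_def)
  ultimately show ?thesis using that gp cardY by blast
qed

theorem theorem2p5:
  "\<exists>(A :: real \<Rightarrow> real) (B :: real \<Rightarrow> real) (K :: real \<Rightarrow> real) (L :: real \<Rightarrow> real).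
     (\<forall>\<epsilon>>0. A \<epsilon> > 0 \<and> B \<epsilon> > 0) \<and>
     (\<forall>\<alpha>. 0 < \<alpha> \<and> \<alpha> < 1 \<longrightarrow> K \<alpha> > 0 \<and> L \<alpha> > 0) \<and>
     (\<forall>(p :: nat) (\<alpha> :: real) (\<epsilon> :: real) (m :: int).
        prime p \<and> 0 < \<alpha> \<and> \<alpha> < 1 \<and> \<epsilon> > 0 \<and>
        A \<epsilon> \<le> real_of_int m \<and> real_of_int m \<le> B \<epsilon> * real p powr (1 - \<epsilon>) \<longrightarrow>
        (\<exists>Y S. Y \<subseteq> carrier (prime_field p) \<and>
               3 \<le> card Y \<and>
               comparable (K \<alpha>) (real (card Y)) (real_of_int m) \<and>
               S \<subseteq> lines (prime_field p) \<and>
               general_position (prime_field p) S \<and>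
               (\<forall>l \<in> S. rich \<alpha> Y l) \<and>
               comparable (L \<alpha>) (ln (real (card S)))
                 (sqrt (ln (real (card Y)) / ln (ln (real (card Y)))))))"
proof -
  \<comment> \<open>The ceiling ensures \<open>3 / d \<alpha> \<le> 1 - \<alpha>\<close>, the
    summand 4 ensures \<open>d \<alpha> \<ge> 4\<close>.\<close>
  define d where "d \<alpha> = nat \<lceil>3 / (1 - \<alpha>)\<rceil> + 4" for \<alpha> :: real
  \<comment> \<open>The constant of the construction plus the threshold below which the two lines
    are used; \<open>L\<close> is a sum of the same kind.\<close>
  define K where "K \<alpha> = 64 * real (d \<alpha>) + 2 ^ (80 * d \<alpha>)" for \<alpha>
  define s where "s = sqrt (ln (real 3) / ln (ln (real 3)))"
  define c where "c = ln 2 / s + s / ln 2"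
  define L where "L \<alpha> = 320 * real (d \<alpha>) + c" for \<alpha>
  \<comment> \<open>That ln 3 exceeds 1, so that ln ln 3 is positive, follows from ln (5/6) \<le>
    -1/6 and (6/5)^6 < 3.\<close>
  have "1 \<le> 6 * ln (6 / 5 :: real)" using ln_le_minus_one[of "5 / 6 :: real"] by (simp add: ln_div)
  also have "\<dots> = ln ((6 / 5 :: real) ^ 6)" by (subst ln_realpow) auto
  also have "\<dots> < ln 3" by (subst ln_less_cancel_iff) (auto simp: power_divide)
  finally have "1 < ln (3 :: real)" .
  hence s: "s > 0" by (simp add: s_def)
  have c: "comparable c (ln 2) s" "c \<ge> 0" using s by (auto simp: comparable_iff c_def field_simps)
  show ?thesis
  \<comment> \<open>With these values the range of \<open>m\<close> gives 5 \<le> m \<le> p.\<close>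
  proof (rule exI[of _ "\<lambda>_. 5"], rule exI[of _ "\<lambda>_. 1"], rule exI[of _ K], rule exI[of _ L],
      intro conjI allI impI)
    fix \<alpha> :: real
    show "K \<alpha> > 0" by (simp add: K_def add_nonneg_pos)
    show "L \<alpha> > 0" using c by (simp add: L_def d_def add_pos_nonneg)
  next
    fix p :: nat and \<alpha> \<epsilon> :: real and m :: int
    assume *: "prime p \<and> 0 < \<alpha> \<and> \<alpha> < 1 \<and> \<epsilon> > 0 \<and> 5 \<le> real_of_int m \<and>
      real_of_int m \<le> 1 * real p powr (1 - \<epsilon>)"
    define n where "n = nat m"
    have m: "m = int n" "n \<ge> 5" using * by (auto simp: n_def)
    have "real p powr (1 - \<epsilon>) \<le> real p powr 1"
      using * prime_ge_1_nat[of p] by (intro powr_mono) auto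
    hence "real n \<le> real p" using * m(1) by auto
    hence np: "n \<le> p" by simp
    have d4: "d \<alpha> \<ge> 4" by (simp add: d_def)
    have "3 / (1 - \<alpha>) \<le> real (d \<alpha>)" unfolding d_def by linarith
    hence d\<alpha>: "3 / real (d \<alpha>) \<le> 1 - \<alpha>" using * d4 by (simp add: field_simps)
    show "\<exists>Y S. Y \<subseteq> carrier (prime_field p) \<and> 3 \<le> card Y \<and>
        comparable (K \<alpha>) (real (card Y)) (real_of_int m) \<and> S \<subseteq> lines (prime_field p) \<and>
        general_position (prime_field p) S \<and> (\<forall>l \<in> S. rich \<alpha> Y l) \<and>
        comparable (L \<alpha>) (ln (real (card S))) (sqrt (ln (real (card Y)) / ln (ln (real (card Y)))))"
    proof (cases "2 ^ (80 * d \<alpha>) \<le> n")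
      case True
      obtain Y S r where YS: "Y \<subseteq> carrier (prime_field p)" "card Y \<le> n" "n \<le> 64 * d \<alpha> * card Y"
        "S \<subseteq> lines (prime_field p)" "general_position (prime_field p) S"
        "\<forall>l\<in>S. rich \<alpha> Y l" "card S = 2 ^ r"
        and r: "r \<ge> 2" "r ^ (20 * d \<alpha> * r\<^sup>2) \<le> n" "n < (r + 1) ^ (20 * d \<alpha> * (r + 1)\<^sup>2)"
        using exists_rich_lines_of_size[OF _ d4 d\<alpha> True np] * by blast
      note sb = scale_bounds[OF d4 r(1) YS(2,3) r(2,3)]
      have "real (card S) = 2 ^ r" by (simp add: YS(7))
      hence lnS: "ln (real (card S)) = real r * ln 2" by (simp add: ln_realpow)
      have cmp: "comparable (2 * real (160 * d \<alpha>)) (real r * ln 2)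
          (sqrt (ln (real (card Y)) / ln (ln (real (card Y)))))"
        using sb d4 r(1) by (intro comparable_sqrt_ln_ratio(2)) auto
      have "comparable (L \<alpha>) (ln (real (card S))) (sqrt (ln (real (card Y)) / ln (ln (real (card Y)))))"
        unfolding lnS
      proof (rule comparable_mono[OF cmp])
        show "0 \<le> sqrt (ln (real (card Y)) / ln (ln (real (card Y))))"
          using sb d4 r(1) by (intro comparable_sqrt_ln_ratio(1)[of r "160 * d \<alpha>"]) auto
      qed (use c in \<open>auto simp: L_def\<close>)
      moreover have "comparable (K \<alpha>) (real (card Y)) (real_of_int m)"
      proof (rule comparable_mono)
        have "real n \<le> real (64 * d \<alpha> * card Y)" using YS(3) by (simp only: of_nat_le_iff)
        moreover have "real (card Y) * 1 \<le> real n * (64 * real (d \<alpha>))"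
          using YS(2) d4 by (intro mult_mono) auto
        ultimately show "comparable (64 * real (d \<alpha>)) (real (card Y)) (real_of_int m)"
          by (simp add: comparable_iff m(1) mult.commute)
      qed (use m in \<open>auto simp: K_def\<close>)
      moreover have "3 \<le> card Y"
      proof -
        have "2 ^ 2 \<le> r ^ (4 * r\<^sup>2)"
          using r(1) by (intro order_trans[OF power_mono[of 2 r 2] power_increasing])
            (auto simp: power2_eq_square)
        thus ?thesis using sb(1) by simp
      qed
      ultimately show ?thesis using YS by blast
    next
      \<comment> \<open>Now \<open>m\<close> lies between 5 and a bound depending only on \<alpha>,
        so a set of size 3 is comparable with it.\<close>
      case False
      obtain Y S where YS: "Y \<subseteq> carrier (prime_field p)" "card Y = 3" "S \<subseteq> lines (prime_field p)"
        "general_position (prime_field p) S" "\<forall>l\<in>S. rich \<alpha> Y l" "card S = 2"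
        using exists_two_rich_lines[of p \<alpha>] * m np by auto
      have "comparable (L \<alpha>) (ln (real (card S))) (sqrt (ln (real (card Y)) / ln (ln (real (card Y)))))"
        unfolding YS s_def[symmetric] using comparable_mono[OF c(1), of "L \<alpha>"] s by (simp add: L_def)
      moreover have "comparable (K \<alpha>) (real (card Y)) (real_of_int m)"
      proof (rule comparable_mono)
        have "n \<le> 2 ^ (80 * d \<alpha>) * 3" using False by linarith
        hence "real n \<le> real (2 ^ (80 * d \<alpha>) * 3)" by (simp only: of_nat_le_iff)
        hence "real n \<le> 2 ^ (80 * d \<alpha>) * 3" by simp
        moreover have "1 * 3 \<le> (2 :: real) ^ (80 * d \<alpha>) * real n" using m by (intro mult_mono) auto
        ultimately show "comparable (2 ^ (80 * d \<alpha>)) (real (card Y)) (real_of_int m)"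
          by (simp add: comparable_iff m(1) YS(2))
      qed (use m in \<open>auto simp: K_def\<close>)
      moreover have "3 \<le> card Y" using YS(2) by simp
      ultimately show ?thesis using YS(1,3-5) by blast
    qed
  qed auto
qed



end
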